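(* Fix a cube $Q_0\subset\mathbb{R}^n$, a local oscillation $\mathbb{B}_{Q_0}=\{B_Q\}_{Q\in\mathcal{D}(Q_0)}$ with constant $C_{\mathbb{B}}$ (write $A_Q=I-B_Q$), and $w\in GR^{\rm dyadic}_{\mathbb{B}_{Q_0},\varepsilon}(Q_0)$. If $0<\varepsilon<1$ is small enough (for instance, $0<\varepsilon<2^{-(n+2)}C_{\mathbb{B}}^{-1}$), there exists $p(\varepsilon)>1$ such that for every $1\le p<p(\varepsilon)$, $$\Big(\frac1{|Q|}\int_Q|B_Qw(x)|^p\,dx\Big)^{1/p}\le C\,\varepsilon\,\frac1{|Q|}\int_Q|A_Qw(x)|\,dx$$ for every $Q\in\mathcal{D}(Q_0)$. Moreover, $p(\varepsilon)\to\infty$ as $\varepsilon\to0^+$. Therefore $w\in RH_p^{\rm dyadic}(Q_0)$ for every $1\le p<p(\varepsilon)$, that is, $$\Big(\frac1{|Q|}\int_Qw(x)^p\,dx\Big)^{1/p}\lesssim\frac1{|Q|}\int_Qw(x)\,dx$$ for every $Q\in\mathcal{D}(Q_0)$.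
   Context: $\mathcal{D}(Q_0)$ is the family of dyadic subcubes of the cube $Q_0$ (including $Q_0$ itself). $|E|$ is Lebesgue measure. $C$ denotes a constant, and $\lesssim$ means inequality up to a multiplicative constant. A family $\mathbb{B}_{Q_0}=\{B_Q\}_{Q\in\mathcal{D}(Q_0)}$ is a local oscillation, with constant $C_{\mathbb{B}}$, if, after setting $A_Q:=I-B_Q$, the following hold: (a) for every $Q\in\mathcal{D}(Q_0)$, $A_Q$ is a linear operator acting on functions in $L^1(Q_0)$; (b) for every $Q\in\mathcal{D}(Q_0)$, $\|A_Qf\|_{L^\infty(Q)}\le C_{\mathbb{B}}\frac1{|Q|}\int_Q|f(y)|\,dy$; (c) for every $Q_1,Q_2\in\mathcal{D}(Q_0)$ with $Q_1\subset Q_2$, $B_{Q_1}A_{Q_2}f=0$ a.e. in $Q_1$ (equivalently, $A_{Q_1}A_{Q_2}f=A_{Q_2}f$ a.e. in $Q_1$). Conditions (a) and (b) imply $(A_Qf)\chi_Q=A_Q(f\chi_Q)\chi_Q$. For $0\le w\in L^1(Q_0)$, one says $w\in GR^{\rm dyadic}_{\mathbb{B}_{Q_0},\varepsilon}(Q_0)$ if for every $Q\in\mathcal{D}(Q_0)$, $$\frac1{|Q|}\int_Q|B_Qw(x)|\,dx=\frac1{|Q|}\int_Q|w(x)-A_Qw(x)|\,dx\le\varepsilon\,\frac1{|Q|}\int_Q|A_Qw(x)|\,dx.$$ *)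

theory Defs
  imports "HOL-Analysis.Analysis"
begin

text \<open>
  Cubes are taken half-open, so that the dyadic subcubes of a given generation partition the
  original cube; this matters only up to null sets.
\<close>

definition cube :: "'a::euclidean_space \<Rightarrow> real \<Rightarrow> 'a set" where
  "cube a l = {x. \<forall>b\<in>Basis. a \<bullet> b \<le> x \<bullet> b \<and> x \<bullet> b < a \<bullet> b + l}"

definition is_cube :: "'a::euclidean_space set \<Rightarrow> bool" where
  "is_cube Q \<longleftrightarrow> (\<exists>a l. 0 < l \<and> Q = cube a l)"

text \<open>
  The vector \<open>m\<close> ranges over the integer points with coordinates in \<open>{0, ..., 2^k - 1}\<close>;
  \<open>k\<close> is the generation. For \<open>k = 0\<close> this gives \<open>Q0\<close> itself.
\<close>

definition dyadic_subcubes :: "'a::euclidean_space set \<Rightarrow> 'a set set" where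
  "dyadic_subcubes Q0 =
    {Q. \<exists>a l k m. 0 < l \<and> Q0 = cube a l \<and>
          (\<forall>b\<in>Basis. \<exists>j::nat. j < 2 ^ k \<and> m \<bullet> b = real j) \<and>
          Q = cube (a + (l / 2 ^ k) *\<^sub>R m) (l / 2 ^ k)}"

definition avg :: "'a::euclidean_space set \<Rightarrow> ('a \<Rightarrow> real) \<Rightarrow> real" where
  "avg Q g = (1 / measure lebesgue Q) * (LINT x:Q|lebesgue. g x)"

text \<open>
  The space \<open>L\<^sup>1(Q0)\<close> consists of functions modulo equality a.e. on \<open>Q0\<close>. We work
  with representatives, so an operator on it has to respect a.e. equality, and
  linearity is required up to null sets. The value type \<open>'b\<close> covers real and complex scalars.
\<close>

definition L1_on ::
  "'a::euclidean_space set \<Rightarrow> ('a \<Rightarrow> 'b::{real_normed_field,banach,second_countable_topology}) set"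
  where "L1_on Q0 = {f. set_integrable lebesgue Q0 f}"

definition linear_operator_L1 ::
  "'a::euclidean_space set \<Rightarrow>
    (('a \<Rightarrow> 'b::{real_normed_field,banach,second_countable_topology}) \<Rightarrow> 'a \<Rightarrow> 'b) \<Rightarrow> bool"
  where
  "linear_operator_L1 Q0 T \<longleftrightarrow>
    (\<forall>f\<in>L1_on Q0. T f \<in> L1_on Q0) \<and>
    (\<forall>f\<in>L1_on Q0. \<forall>g\<in>L1_on Q0.
      (AE x\<in>Q0 in lebesgue. f x = g x) \<longrightarrow> (AE x\<in>Q0 in lebesgue. T f x = T g x)) \<and>
    (\<forall>f\<in>L1_on Q0. \<forall>g\<in>L1_on Q0.
      AE x\<in>Q0 in lebesgue. T (\<lambda>y. f y + g y) x = T f x + T g x) \<and>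
    (\<forall>f\<in>L1_on Q0. \<forall>c.
      AE x\<in>Q0 in lebesgue. T (\<lambda>y. c * f y) x = c * T f x)"

definition compl_op :: "('i \<Rightarrow> ('a \<Rightarrow> 'b::ab_group_add) \<Rightarrow> 'a \<Rightarrow> 'b) \<Rightarrow> 'i \<Rightarrow> ('a \<Rightarrow> 'b) \<Rightarrow> 'a \<Rightarrow> 'b"
  where "compl_op B Q f = (\<lambda>x. f x - B Q f x)"

text \<open>
  The second condition is the bound for the norm of \<open>A Q f\<close> in \<open>L\<^sup>\<infinity>(Q)\<close>, with the
  essential supremum written out.
\<close>

definition local_oscillation ::
  "'a::euclidean_space set \<Rightarrow>
    ('a set \<Rightarrow> ('a \<Rightarrow> 'b::{real_normed_field,banach,second_countable_topology}) \<Rightarrow> 'a \<Rightarrow> 'b) \<Rightarrow>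
    real \<Rightarrow> bool"
  where
  "local_oscillation Q0 B CB \<longleftrightarrow>
    (let A = compl_op B in
      (\<forall>Q\<in>dyadic_subcubes Q0. linear_operator_L1 Q0 (A Q)) \<and>
      (\<forall>Q\<in>dyadic_subcubes Q0. \<forall>f\<in>L1_on Q0.
        AE x\<in>Q in lebesgue. norm (A Q f x) \<le> CB * avg Q (\<lambda>y. norm (f y))) \<and>
      (\<forall>Q1\<in>dyadic_subcubes Q0. \<forall>Q2\<in>dyadic_subcubes Q0. Q1 \<subseteq> Q2 \<longrightarrow>
        (\<forall>f\<in>L1_on Q0. AE x\<in>Q1 in lebesgue. B Q1 (A Q2 f) x = 0)))"

definition GR_dyadic ::
  "('a::euclidean_space set \<Rightarrow>
      ('a \<Rightarrow> 'b::{real_normed_field,banach,second_countable_topology}) \<Rightarrow> 'a \<Rightarrow> 'b) \<Rightarrow>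
    real \<Rightarrow> 'a set \<Rightarrow> ('a \<Rightarrow> real) set"
  where
  "GR_dyadic B \<epsilon> Q0 =
    {w. set_integrable lebesgue Q0 w \<and> (AE x\<in>Q0 in lebesgue. 0 \<le> w x) \<and>
        (\<forall>Q\<in>dyadic_subcubes Q0.
          avg Q (\<lambda>x. norm (B Q (\<lambda>y. of_real (w y)) x))
            \<le> \<epsilon> * avg Q (\<lambda>x. norm (compl_op B Q (\<lambda>y. of_real (w y)) x)))}"

text \<open>
  The Lebesgue integral of a non-integrable function is \<open>0\<close> by convention, so finiteness of the
  \<open>p\<close>-th power integral is asserted separately.
\<close>

definition Lp_avg_le :: "real \<Rightarrow> 'a::euclidean_space set \<Rightarrow> ('a \<Rightarrow> real) \<Rightarrow> real \<Rightarrow> bool" where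
  "Lp_avg_le p Q g K \<longleftrightarrow>
    set_integrable lebesgue Q (\<lambda>x. g x powr p) \<and> (avg Q (\<lambda>x. g x powr p)) powr (1 / p) \<le> K"

definition RH_dyadic :: "real \<Rightarrow> 'a::euclidean_space set \<Rightarrow> ('a \<Rightarrow> real) set" where
  "RH_dyadic p Q0 =
    {w. set_integrable lebesgue Q0 w \<and> (AE x\<in>Q0 in lebesgue. 0 \<le> w x) \<and>
        (\<exists>C. \<forall>Q\<in>dyadic_subcubes Q0. Lp_avg_le p Q w (C * avg Q w))}"

end

theory Submission
  imports Defs
begin

text \<open>
  Fix \<open>Q\<close> and perform a Calderon--Zygmund decomposition of \<open>\<bar>B\<^sub>Q w\<bar>\<close> at height
  \<open>\<lambda> = K \<epsilon> avg\<^sub>Q \<bar>A\<^sub>Q w\<bar>\<close>. By the Gurov--Reshetnyak condition the selected cubes \<open>R\<close> cover at most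
  a fraction \<open>1/K\<close> of \<open>Q\<close>. On each of them \<open>A\<^sub>R A\<^sub>Q w = A\<^sub>Q w\<close> gives
  \<open>B\<^sub>Q w = B\<^sub>R w + A\<^sub>R B\<^sub>Q w\<close> and \<open>A\<^sub>R w = A\<^sub>Q w + A\<^sub>R B\<^sub>Q w\<close> with \<open>\<bar>A\<^sub>R B\<^sub>Q w\<bar> \<le> C\<^sub>B 2\<^sup>n \<lambda>\<close>, so that
  the oscillation on \<open>Q\<close> is controlled by that on \<open>R\<close>, while \<open>avg\<^sub>R \<bar>A\<^sub>R w\<bar>\<close> exceeds
  \<open>avg\<^sub>Q \<bar>A\<^sub>Q w\<bar>\<close> by a factor at most \<open>3M\<close>, \<open>M = max 1 C\<^sub>B\<close>. With \<open>K = (4M)\<^sup>p\<close> the \<open>p\<close>-th moments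
  contract under iteration: the loss \<open>(3M)\<^sup>p\<close> is beaten by the gain \<open>1/K\<close>. The factor \<open>3M\<close> requires
  \<open>C\<^sub>B 2\<^sup>n \<epsilon> (4M)\<^sup>p\<^sup>-\<^sup>1 \<le> 1/4\<close>, and this determines \<open>p(\<epsilon>)\<close>.
\<close>

section \<open>Dyadic cubes\<close>

text \<open>
  \<open>dcube a l k x\<close> is the cube containing \<open>x\<close> of the grid of mesh \<open>l / 2\<^sup>k\<close> based at \<open>a\<close>.
\<close>

definition dcube :: "'a::euclidean_space \<Rightarrow> real \<Rightarrow> nat \<Rightarrow> 'a \<Rightarrow> 'a set" where
  "dcube a l k x = {y. \<forall>b\<in>Basis. \<lfloor>2 ^ k * ((y - a) \<bullet> b) / l\<rfloor> = \<lfloor>2 ^ k * ((x - a) \<bullet> b) / l\<rfloor>}"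

lemma dcube_self [simp]: "x \<in> dcube a l k x"
  by (simp add: dcube_def)

lemma dcube_eq: "y \<in> dcube a l k x \<Longrightarrow> dcube a l k y = dcube a l k x"
  by (auto simp: dcube_def)

text \<open>The coarse grid index is the integer quotient of the fine one by
  \<open>2 ^ (k - j)\<close>, so points with the same fine index share the coarse one. The floor
  encoding makes nesting a fact about integer division.\<close>

lemma dcube_antimono:
  assumes "j \<le> k" shows "dcube a l k x \<subseteq> dcube a l j x"
proof -
  have *: "\<lfloor>2 ^ j * t / l\<rfloor> = \<lfloor>2 ^ k * t / l\<rfloor> div 2 ^ (k - j)" for t
  proof -
    have "2 ^ k = 2 ^ j * (2::real) ^ (k - j)"
      using assms by (simp flip: power_add)
    then have "2 ^ j * t / l = (2 ^ k * t / l) / real_of_int (2 ^ (k - j))"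
      by simp
    then show ?thesis
      using floor_divide_real_eq_div[of "2 ^ (k - j)" "2 ^ k * t / l"] by simp
  qed
  show ?thesis
    by (auto simp: dcube_def *)
qed

text \<open>The floors are the integer coordinates of the lower corner in units of the mesh. The
  half-open convention in \<open>cube\<close> matches the floor function exactly, so no boundary
  points need separate treatment.\<close>

lemma dcube_eq_cube:
  fixes a x :: "'a::euclidean_space"
  assumes "0 < l"
  shows "dcube a l k x =
    cube (a + (l / 2 ^ k) *\<^sub>R (\<Sum>b\<in>Basis. real_of_int \<lfloor>2 ^ k * ((x - a) \<bullet> b) / l\<rfloor> *\<^sub>R b)) (l / 2 ^ k)"
proof -
  have *: "(\<Sum>b'\<in>Basis. f b' *\<^sub>R b') \<bullet> b = f b" if "b \<in> Basis" for b :: 'a and f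
    using that by (simp add: inner_sum_left inner_Basis if_distrib cong: if_cong)
  have "\<lfloor>2 ^ k * ((y - a) \<bullet> b) / l\<rfloor> = i \<longleftrightarrow>
      (a + (l / 2 ^ k) *\<^sub>R z) \<bullet> b \<le> y \<bullet> b \<and> y \<bullet> b < (a + (l / 2 ^ k) *\<^sub>R z) \<bullet> b + l / 2 ^ k"
    if "z \<bullet> b = of_int i" for i y z and b :: 'a
    using assms that
    by (simp add: floor_eq_iff inner_diff_left inner_add_left field_simps)
  then show ?thesis
    unfolding dcube_def cube_def by (intro Collect_cong ball_cong refl) (simp add: *)
qed

text \<open>The half-open cube is the closed box minus its upper faces, which lie in finitely many
  hyperplanes and are therefore negligible.\<close>

lemma cube_lmeasurable [simp]: "cube a l \<in> lmeasurable"
  and measure_cube: "0 \<le> l \<Longrightarrow> measure lebesgue (cube a l) = l ^ DIM('a)" 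
  for a :: "'a::euclidean_space"
proof -
  let ?b = "a + (\<Sum>b\<in>Basis. l *\<^sub>R b)"
  have ib: "?b \<bullet> b = a \<bullet> b + l" if "b \<in> Basis" for b
    using that by (simp add: inner_sum_left inner_add_left inner_Basis if_distrib cong: if_cong)
  have eq: "cube a l = cbox a ?b - \<Union>((\<lambda>b. {x. x \<bullet> b = a \<bullet> b + l}) ` Basis)"
    by (auto simp: cube_def mem_box ib less_le)
  have neg: "negligible (\<Union>((\<lambda>b. {x. x \<bullet> b = a \<bullet> b + l}) ` (Basis :: 'a set)))"
    by (intro negligible_Union_nat negligible_Union) (auto intro: negligible_standard_hyperplane)
  show "cube a l \<in> lmeasurable"
    unfolding eq using neg by (intro fmeasurable.Diff lmeasurable_cbox negligible_imp_measurable) 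
  assume "0 \<le> l"
  have "measure lebesgue (cube a l) = measure lebesgue (cbox a ?b)"
    unfolding eq using neg by (simp add: measure_Diff_null_set negligible_iff_null_sets)
  also have "\<dots> = l ^ DIM('a)"
    using \<open>0 \<le> l\<close> by (simp add: content_cbox ib)
  finally show "measure lebesgue (cube a l) = l ^ DIM('a)" .
qed

lemma dcube_lmeasurable [simp]: "0 < l \<Longrightarrow> dcube a l k x \<in> lmeasurable"
  by (simp add: dcube_eq_cube)

lemma measure_dcube:
  "0 < l \<Longrightarrow> measure lebesgue (dcube a l k x) = (l / 2 ^ k) ^ DIM('a)" for a :: "'a::euclidean_space"
  by (simp add: dcube_eq_cube measure_cube)

section \<open>Grid cubes as dyadic subcubes\<close>

lemma dcube_0:
  assumes "0 < l" "x \<in> cube a l" shows "dcube a l 0 x = cube a l"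
proof -
  have "\<lfloor>(x - a) \<bullet> b / l\<rfloor> = 0" if "b \<in> Basis" for b
    using assms that by (simp add: floor_eq_iff cube_def inner_diff_left field_simps)
  then show ?thesis
    using assms dcube_eq_cube[of l a 0 x] by simp
qed

lemma dcube_subset_cube:
  assumes "0 < l" "x \<in> cube a l" shows "dcube a l k x \<subseteq> cube a l"
  using dcube_antimono[of 0 k a l x] dcube_0[OF assms] by simp

lemma dcube_in_dyadic_subcubes:
  fixes a x :: "'a::euclidean_space"
  assumes "0 < l" "x \<in> cube a l" shows "dcube a l k x \<in> dyadic_subcubes (cube a l)"
proof -
  let ?m = "\<Sum>b\<in>Basis. real_of_int \<lfloor>2 ^ k * ((x - a) \<bullet> b) / l\<rfloor> *\<^sub>R b"
  have "\<exists>j::nat. j < 2 ^ k \<and> ?m \<bullet> b = real j" if b: "b \<in> Basis" for b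
  proof -
    let ?i = "\<lfloor>2 ^ k * ((x - a) \<bullet> b) / l\<rfloor>"
    have "0 \<le> ?i" "?i < 2 ^ k"
      using mult_strict_left_mono[of "(x - a) \<bullet> b" l "2 ^ k"] assms b
      by (auto simp: cube_def inner_diff_left floor_less_iff divide_less_eq mult_ac)
    then have "nat ?i < 2 ^ k" "real (nat ?i) = ?i"
      by (auto simp: nat_less_iff)
    moreover have "?m \<bullet> b = ?i"
      using b by (simp add: inner_sum_left inner_Basis if_distrib cong: if_cong)
    ultimately show ?thesis by metis
  qed
  then show ?thesis
    unfolding dyadic_subcubes_def using assms dcube_eq_cube[OF assms(1), of a k x] by blast
qed

text \<open>The lower corner of \<open>Q\<close> serves as the point \<open>x\<close>: its grid
  index is the integer vector \<open>m\<close>, and half-openness puts it in \<open>Q0\<close>. From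
  here on dyadic subcubes are handled only through \<open>dcube\<close>.\<close>

lemma dyadic_subcubeE:
  fixes Q0 :: "'a::euclidean_space set"
  assumes "Q \<in> dyadic_subcubes Q0"
  obtains a l k x where "0 < l" "Q0 = cube a l" "x \<in> Q0" "Q = dcube a l k x"
proof -
  from assms obtain a l k m where l: "0 < l" and Q0: "Q0 = cube a l"
    and m: "\<And>b. b \<in> Basis \<Longrightarrow> \<exists>j::nat. j < 2 ^ k \<and> m \<bullet> b = real j"
    and Q: "Q = cube (a + (l / 2 ^ k) *\<^sub>R m) (l / 2 ^ k)"
    unfolding dyadic_subcubes_def by blast
  define x where "x = a + (l / 2 ^ k) *\<^sub>R m"
  have fl: "real_of_int \<lfloor>2 ^ k * ((x - a) \<bullet> b) / l\<rfloor> = m \<bullet> b" if "b \<in> Basis" for b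
  proof -
    from m[OF that] obtain j :: nat where j: "m \<bullet> b = real j" by blast
    then have "2 ^ k * ((x - a) \<bullet> b) / l = real j"
      using l by (simp add: x_def)
    then show ?thesis by (simp add: j)
  qed
  have "(\<Sum>b\<in>Basis. real_of_int \<lfloor>2 ^ k * ((x - a) \<bullet> b) / l\<rfloor> *\<^sub>R b) = m"
    by (simp add: fl euclidean_representation)
  then have "Q = dcube a l k x"
    using dcube_eq_cube[OF l, of a k x] Q by simp
  moreover have "x \<in> Q0"
    unfolding Q0 cube_def
  proof (intro CollectI ballI)
    fix b :: 'a assume "b \<in> Basis"
    from m[OF this] obtain j :: nat where j: "j < 2 ^ k" "m \<bullet> b = real j" by blast
    have "real j < 2 ^ k" using j(1) by (metis of_nat_less_iff of_nat_numeral of_nat_power)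
    then show "a \<bullet> b \<le> x \<bullet> b \<and> x \<bullet> b < a \<bullet> b + l"
      using l j(2) by (simp add: x_def inner_add_left field_simps)
  qed
  ultimately show ?thesis using that l Q0 by blast
qed

text \<open>Points of one cube of generation \<open>j\<close> differ by at most
  \<open>l / 2 ^ j\<close> in each coordinate, so by comparison with the l1 norm their distance is
  at most \<open>DIM('a) * l / 2 ^ j\<close>, which tends to 0.\<close>

lemma dcube_subset_open:
  fixes a x :: "'a::euclidean_space"
  assumes "0 < l" "open U" "x \<in> U"
  obtains j where "k \<le> j" "dcube a l j x \<subseteq> U"
proof -
  obtain e where e: "e > 0" "ball x e \<subseteq> U"
    using assms(2,3) openE by blast
  have "(\<lambda>j. DIM('a) * l / 2 ^ j) \<longlonglongrightarrow> 0"
    by (intro LIMSEQ_divide_realpow_zero) auto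
  then have "\<forall>\<^sub>F j in sequentially. DIM('a) * l / 2 ^ j < e \<and> k \<le> j"
    using e(1) by (intro eventually_conj order_tendstoD eventually_ge_at_top)
  then obtain j where j: "DIM('a) * l / 2 ^ j < e" "k \<le> j"
    by (auto simp: eventually_sequentially)
  have "y \<in> ball x e" if y: "y \<in> dcube a l j x" for y
  proof -
    have "\<bar>(x - y) \<bullet> b\<bar> \<le> l / 2 ^ j" if "b \<in> Basis" for b
    proof -
      have "\<lfloor>2 ^ j * ((y - a) \<bullet> b) / l\<rfloor> = \<lfloor>2 ^ j * ((x - a) \<bullet> b) / l\<rfloor>"
        using y that by (simp add: dcube_def)
      then have "\<bar>2 ^ j * ((x - a) \<bullet> b) / l - 2 ^ j * ((y - a) \<bullet> b) / l\<bar> \<le> 1"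
        by linarith
      also have "2 ^ j * ((x - a) \<bullet> b) / l - 2 ^ j * ((y - a) \<bullet> b) / l = 2 ^ j / l * ((x - y) \<bullet> b)"
        by (simp add: inner_diff_left algebra_simps add_divide_distrib diff_divide_distrib)
      finally show ?thesis
        using assms(1) by (simp add: abs_mult field_simps)
    qed
    then have "norm (x - y) \<le> (\<Sum>b\<in>(Basis :: 'a set). l / 2 ^ j)"
      by (intro order.trans[OF norm_le_l1] sum_mono)
    then show ?thesis using j(1) by (simp add: dist_norm)
  qed
  then show ?thesis using that j(2) e(2) by blast
qed

text \<open>Each point of \<open>S\<close> stops at the first generation from \<open>k\<close> on
  whose cube satisfies \<open>P\<close>. The selected cubes are the maximal ones, hence disjoint.
  The same selection serves both to cover by cubes inside an open set and to stop where an average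
  exceeds a height.\<close>

lemma dcube_stopping:
  fixes a :: "'a::euclidean_space"
  assumes l: "0 < l" and ex: "\<And>x. x \<in> S \<Longrightarrow> \<exists>j\<ge>k. P (dcube a l j x)"
  obtains F where "countable F" "disjoint F" "S \<subseteq> \<Union>F"
    "\<forall>R\<in>F. P R \<and> (\<exists>x\<in>S. \<exists>j\<ge>k. R = dcube a l j x \<and>
       (\<forall>i. k \<le> i \<and> i < j \<longrightarrow> \<not> P (dcube a l i x)))"
proof -
  define J where "J x = (LEAST j. k \<le> j \<and> P (dcube a l j x))" for x
  have J: "k \<le> J x" "P (dcube a l (J x) x)" if "x \<in> S" for x
    using LeastI_ex[of "\<lambda>j. k \<le> j \<and> P (dcube a l j x)"] ex[OF that] unfolding J_def by blast+
  have Jmin: "\<not> P (dcube a l i x)" if "k \<le> i" "i < J x" for i x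
    using not_less_Least[of i "\<lambda>j. k \<le> j \<and> P (dcube a l j x)"] that unfolding J_def by blast
  define R where "R x = dcube a l (J x) x" for x
  \<comment> \<open>If two stopping cubes meet, then \<open>x\<close> and \<open>y\<close> already
    share a cube at the coarser generation \<open>J x\<close>. That cube satisfies \<open>P\<close>,
    so minimality rules out \<open>J x < J y\<close>.\<close>
  have *: "R x = R y" if "x \<in> S" "y \<in> S" "z \<in> R x" "z \<in> R y" "J x \<le> J y" for x y z
  proof -
    have "z \<in> dcube a l (J x) y"
      using that(4,5) dcube_antimono unfolding R_def by blast
    then have eq: "dcube a l (J x) y = dcube a l (J x) x"
      using that(3) dcube_eq unfolding R_def by metis
    with J[OF that(1)] Jmin[of "J x" y] that(5) have "J x = J y"
      by (metis order.not_eq_order_implies_strict)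
    with eq show ?thesis by (simp add: R_def)
  qed
  have disj: "disjoint (R ` S)"
  proof (rule disjointI)
    fix A B assume "A \<in> R ` S" "B \<in> R ` S" "A \<noteq> B"
    then obtain x y where xy: "x \<in> S" "y \<in> S" "A = R x" "B = R y" "R x \<noteq> R y" by blast
    then have "z \<notin> R x \<or> z \<notin> R y" for z
      using *[of x y z] *[of y x z] by (metis linear)
    then show "A \<inter> B = {}" using xy by blast
  qed
  \<comment> \<open>Disjoint sets with nonempty interiors form a countable family, whatever the size
    of \<open>S\<close>.\<close>
  have "interior (R x) \<noteq> {}" for x
  proof -
    have "interior (cube c r) \<noteq> {}" if "0 < r" for c :: 'a and r
    proof -
      let ?d = "c + (\<Sum>b\<in>Basis. r *\<^sub>R b)"
      have d: "?d \<bullet> b = c \<bullet> b + r" if "b \<in> Basis" for b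
        using that by (simp add: inner_add_left inner_sum_left inner_Basis if_distrib cong: if_cong)
      have "box c ?d \<subseteq> interior (cube c r)"
        by (intro interior_maximal open_box) (auto simp: cube_def mem_box d less_imp_le)
      moreover have "box c ?d \<noteq> {}"
        using that by (simp add: box_ne_empty d)
      ultimately show ?thesis by blast
    qed
    then show ?thesis
      using l by (simp add: R_def dcube_eq_cube)
  qed
  then have "countable (R ` S)"
    using disj by (intro countable_disjoint_nonempty_interior_subsets)
       (auto simp: disjoint_def)
  moreover have "S \<subseteq> \<Union>(R ` S)" by (auto simp: R_def)
  moreover have "P (R x) \<and> (\<exists>y\<in>S. \<exists>j\<ge>k. R x = dcube a l j y \<and>
      (\<forall>i. k \<le> i \<and> i < j \<longrightarrow> \<not> P (dcube a l i y)))" if "x \<in> S" for x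
    using J[OF that] Jmin that unfolding R_def by blast
  ultimately show ?thesis
    using disj by (intro that[of "R ` S"]) auto
qed

section \<open>Calderon--Zygmund decomposition\<close>

text \<open>Estimates are carried out with nonnegative integrals, where integrability is no side
  condition, while the hypotheses speak of \<open>avg\<close>; this lemma translates between the
  two.\<close>

lemma set_nn_integral_eq_avg:
  assumes "set_integrable lebesgue Q g" "AE x\<in>Q in lebesgue. 0 \<le> g x" "0 < measure lebesgue Q"
  shows "(\<integral>\<^sup>+x\<in>Q. ennreal (g x) \<partial>lebesgue) = ennreal (avg Q g * measure lebesgue Q)"
proof -
  have "(\<integral>\<^sup>+x\<in>Q. ennreal (g x) \<partial>lebesgue) = (\<integral>\<^sup>+x. ennreal (indicator Q x *\<^sub>R g x) \<partial>lebesgue)"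
    by (intro nn_integral_cong) (auto simp: indicator_def)
  also have "\<dots> = ennreal (LINT x:Q|lebesgue. g x)"
    unfolding set_lebesgue_integral_def using assms
    by (intro nn_integral_eq_integral) (auto simp: set_integrable_def indicator_def elim: AE_mp)
  finally show ?thesis
    using assms(3) by (simp add: avg_def)
qed

lemma avg_nonneg:
  assumes "AE x\<in>Q in lebesgue. 0 \<le> g x" shows "0 \<le> avg Q g"
  unfolding avg_def set_lebesgue_integral_def
  using assms by (intro mult_nonneg_nonneg integral_nonneg_AE) (auto simp: indicator_def elim: AE_mp)

text \<open>Countable additivity of both measures. With one of them Lebesgue measure and the other a
  density, bounds on averages over disjoint cubes become an integral inequality over their
  union.\<close>

lemma emeasure_Union_le_mult:
  assumes "countable F" "disjoint F" "F \<subseteq> sets M" "sets N = sets M"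
    and "\<And>R. R \<in> F \<Longrightarrow> emeasure M R \<le> c * emeasure N R"
  shows "emeasure M (\<Union>F) \<le> c * emeasure N (\<Union>F)"
proof -
  have disj: "disjoint_family_on (\<lambda>R. R) F"
    using assms(2) by (auto simp: disjoint_family_on_def disjoint_def)
  have "emeasure M (\<Union>F) = (\<integral>\<^sup>+R. emeasure M R \<partial>count_space F)"
    using emeasure_UN_countable[OF _ assms(1) disj, of M] assms(3) by auto
  also have "\<dots> \<le> (\<integral>\<^sup>+R. c * emeasure N R \<partial>count_space F)"
    using assms(5) by (intro nn_integral_mono) auto
  also have "\<dots> = c * (\<integral>\<^sup>+R. emeasure N R \<partial>count_space F)"
    by (intro nn_integral_cmult) auto
  also have "(\<integral>\<^sup>+R. emeasure N R \<partial>count_space F) = emeasure N (\<Union>F)"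
    using emeasure_UN_countable[OF _ assms(1) disj, of N] assms(3,4) by (simp add: subset_iff)
  finally show ?thesis .
qed

lemma set_integrable_imp_measurable: "set_integrable M A f \<Longrightarrow> set_borel_measurable M A f"
  by (simp add: set_integrable_def set_borel_measurable_def borel_measurable_integrable)

text \<open>The indicator is built into the density because \<open>g\<close> is assumed measurable
  only on \<open>Q\<close>.\<close>

lemma emeasure_density_indicator_mult:
  assumes "set_borel_measurable lebesgue Q (g :: 'a::euclidean_space \<Rightarrow> real)" "R \<subseteq> Q" "R \<in> sets lebesgue"
  shows "emeasure (density lebesgue (\<lambda>x. ennreal (indicator Q x * g x))) R = (\<integral>\<^sup>+x\<in>R. ennreal (g x) \<partial>lebesgue)"
proof -
  have "(\<lambda>x. indicator Q x * g x) \<in> borel_measurable lebesgue"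
    using assms(1) by (simp add: set_borel_measurable_def)
  then have "emeasure (density lebesgue (\<lambda>x. ennreal (indicator Q x * g x))) R
      = (\<integral>\<^sup>+x\<in>R. ennreal (indicator Q x * g x) \<partial>lebesgue)"
    using assms(3) by (intro emeasure_density) auto
  also have "\<dots> = (\<integral>\<^sup>+x\<in>R. ennreal (g x) \<partial>lebesgue)"
    using assms(2) by (intro nn_integral_cong) (auto simp: indicator_def)
  finally show ?thesis .
qed

lemma measure_dcube_pos: "0 < l \<Longrightarrow> 0 < measure lebesgue (dcube a l k x)"
  for a :: "'a::euclidean_space"
  by (simp add: measure_dcube)

lemma set_nn_integral_dcube_avg:
  assumes "0 < l" "set_integrable lebesgue Q g" "\<And>x. 0 \<le> g x" "dcube a l j x \<subseteq> Q"
  shows "(\<integral>\<^sup>+y\<in>dcube a l j x. ennreal (g y) \<partial>lebesgue)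
    = ennreal (avg (dcube a l j x) g) * emeasure lebesgue (dcube a l j x)"
proof -
  have "set_integrable lebesgue (dcube a l j x) g"
    using assms by (intro set_integrable_subset[OF assms(2)]) (auto intro: fmeasurableD)
  then show ?thesis
    using assms(1,3) measure_dcube_pos[OF assms(1), of a j x]
    by (simp add: set_nn_integral_eq_avg emeasure_eq_measure2 ennreal_mult avg_nonneg)
qed

text \<open>
  A dyadic Lebesgue differentiation theorem, for upper bounds only: cover the exceptional set by
  dyadic cubes inside an open set of nearly the same measure.
\<close>

lemma null_set_if_dcube_avg_le:
  fixes a :: "'a::euclidean_space"
  assumes l: "0 < l" and Q: "Q = dcube a l k x0" and g: "set_integrable lebesgue Q g" "\<And>x. 0 \<le> g x"
    and S: "S \<in> sets lebesgue" "S \<subseteq> Q"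
    and avg: "\<And>x j. x \<in> S \<Longrightarrow> k \<le> j \<Longrightarrow> avg (dcube a l j x) g \<le> c"
    and c: "0 \<le> c" "0 < d" and ge: "\<And>x. x \<in> S \<Longrightarrow> c + d \<le> g x"
  shows "S \<in> null_sets lebesgue"
proof -
  have QL: "Q \<in> lmeasurable" using Q l by simp
  have SL: "S \<in> lmeasurable" using QL S(2,1) by (rule fmeasurableI2)
  define s where "s = measure lebesgue S"
  have es: "emeasure lebesgue S = ennreal s"
    using SL by (simp add: emeasure_eq_measure2 s_def)
  have s0: "0 \<le> s" by (simp add: s_def)
  define G where "G = density lebesgue (\<lambda>x. ennreal (indicator Q x * g x))"
  have GR: "emeasure G R = (\<integral>\<^sup>+x\<in>R. ennreal (g x) \<partial>lebesgue)" if "R \<subseteq> Q" "R \<in> sets lebesgue" for R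
    unfolding G_def using emeasure_density_indicator_mult[OF set_integrable_imp_measurable[OF g(1)] that] .
  \<comment> \<open>The mass of \<open>g\<close> on \<open>S\<close> is at least
    \<open>(c + d) * s\<close>. Covering \<open>S\<close> by disjoint cubes inside an open set of
    measure at most \<open>s + \<eta>\<close> bounds it by \<open>c * (s + \<eta>)\<close>, since
    every cube used has average at most \<open>c\<close>.\<close>
  have "(c + d) * s \<le> c * (s + \<eta>)" if \<eta>: "0 < \<eta>" for \<eta>
  proof -
    obtain U where U: "open U" "S \<subseteq> U" "U - S \<in> lmeasurable" "emeasure lebesgue (U - S) < ennreal \<eta>"
      using sets_lebesgue_outer_open[OF S(1) \<eta>] by blast
    have "emeasure lebesgue (S \<union> (U - S)) \<le> emeasure lebesgue S + emeasure lebesgue (U - S)"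
      using U(3) S(1) by (intro emeasure_subadditive) (auto intro: fmeasurableD)
    also have "\<dots> \<le> ennreal s + ennreal \<eta>"
      using U(4) by (intro add_mono) (auto simp: es)
    finally have U': "emeasure lebesgue U \<le> ennreal (s + \<eta>)"
      using U(2) s0 \<eta> by (simp add: Un_absorb1)
    have "\<exists>j\<ge>k. dcube a l j x \<subseteq> U" if "x \<in> S" for x
      using dcube_subset_open[OF l U(1), of x k a] U(2) that by blast
    then obtain F where F: "countable F" "disjoint F" "S \<subseteq> \<Union>F"
      and "\<forall>R\<in>F. R \<subseteq> U \<and> (\<exists>x\<in>S. \<exists>j\<ge>k. R = dcube a l j x \<and>
       (\<forall>i. k \<le> i \<and> i < j \<longrightarrow> \<not> dcube a l i x \<subseteq> U))"
      by (rule dcube_stopping[where P = "\<lambda>R. R \<subseteq> U", OF l])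
    note FR = bspec[OF this(4)]
    have RQ: "R \<subseteq> Q \<and> R \<in> sets lebesgue \<and> emeasure G R \<le> ennreal c * emeasure lebesgue R" if "R \<in> F" for R
    proof -
      from FR[OF that] obtain x j where R: "x \<in> S" "k \<le> j" "R = dcube a l j x" by blast
      have "R \<subseteq> Q"
        using R S(2) Q dcube_eq[of x a l k x0] dcube_antimono[of k j a l x] by auto
      moreover have "R \<in> sets lebesgue" using R(3) l by (simp add: fmeasurableD)
      moreover have "emeasure G R = ennreal (avg R g) * emeasure lebesgue R"
        using calculation R(3) set_nn_integral_dcube_avg[OF l g] by (simp add: GR)
      ultimately show ?thesis
        using avg[OF R(1,2)] R(3) by (auto intro!: mult_right_mono ennreal_leI)
    qed
    have "ennreal ((c + d) * s) = (\<integral>\<^sup>+x\<in>S. ennreal (c + d) \<partial>lebesgue)"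
      using c s0 S by (simp add: nn_integral_cmult_indicator es ennreal_mult)
    also have "\<dots> \<le> emeasure G S"
      using ge S by (subst GR) (auto intro!: nn_integral_mono ennreal_leI simp: indicator_def)
    also have "\<dots> \<le> emeasure G (\<Union>F)"
      using F RQ by (intro emeasure_mono) (auto simp: G_def intro!: sets.countable_Union)
    also have "\<dots> \<le> ennreal c * emeasure lebesgue (\<Union>F)"
      by (intro emeasure_Union_le_mult F) (use RQ in \<open>simp_all add: G_def subset_iff del: emeasure_completion\<close>)
    also have "\<dots> \<le> ennreal c * emeasure lebesgue U"
      using FR U(1) by (intro mult_left_mono emeasure_mono) auto
    also have "\<dots> \<le> ennreal c * ennreal (s + \<eta>)"
      using U' by (rule mult_left_mono) simp
    finally have "ennreal ((c + d) * s) \<le> ennreal (c * (s + \<eta>))"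
      using c s0 \<eta> by (simp add: ennreal_mult mult_left_mono)
    then show ?thesis using c s0 \<eta> by (simp add: ennreal_le_iff)
  qed
  then have *: "d * s \<le> c * \<eta>" if "0 < \<eta>" for \<eta> using that by (force simp: algebra_simps)
  have "d * s \<le> 0"
  proof (rule field_le_epsilon)
    fix e :: real assume "0 < e"
    \<comment> \<open>The denominator \<open>c + 1\<close> keeps the choice of \<open>\<eta>\<close>
      valid when \<open>c = 0\<close>.\<close>
    then have "d * s \<le> c * (e / (c + 1))" using c by (intro *) auto
    also have "\<dots> \<le> e" using c \<open>0 < e\<close> by (simp add: field_simps)
    finally show "d * s \<le> 0 + e" by simp
  qed
  then have "s = 0" using c s0 by (simp add: mult_le_0_iff)
  then show ?thesis using S es by (auto simp: null_sets_def)
qed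

text \<open>The exceptional set, where \<open>g\<close> exceeds \<open>c\<close>, is the countable
  union over \<open>n\<close> of the sets where \<open>g\<close> is at least
  \<open>c + 1 / real (Suc n)\<close>, and each of these is null by the preceding lemma.\<close>

lemma AE_le_if_dcube_avg_le:
  fixes a :: "'a::euclidean_space"
  assumes l: "0 < l" and Q: "Q = dcube a l k x0" and g: "set_integrable lebesgue Q g" "\<And>x. 0 \<le> g x"
    and E: "E \<in> sets lebesgue" "E \<subseteq> Q"
    and avg: "\<And>x j. x \<in> E \<Longrightarrow> k \<le> j \<Longrightarrow> avg (dcube a l j x) g \<le> c"
    and c: "0 \<le> c"
  shows "AE x\<in>E in lebesgue. g x \<le> c"
proof -
  have meas: "(\<lambda>x. indicator Q x * g x) \<in> borel_measurable lebesgue"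
    using g(1) unfolding set_integrable_def real_scaleR_def by (rule borel_measurable_integrable)
  define S where "S n = E \<inter> {x. c + 1 / real (Suc n) \<le> indicator Q x * g x}" for n
  have "{x \<in> space lebesgue. c + 1 / real (Suc n) \<le> indicator Q x * g x} \<in> sets lebesgue" for n
    using meas by measurable
  then have SL: "S n \<in> sets lebesgue" for n
    unfolding S_def using E(1) by auto
  have "S n \<in> null_sets lebesgue" for n
    by (rule null_set_if_dcube_avg_le[OF l Q g SL, where c = c and d = "1 / real (Suc n)"])
      (use E avg c in \<open>auto simp: S_def indicator_def split: if_splits\<close>)
  then have "AE x in lebesgue. \<forall>n. x \<notin> S n"
    by (subst AE_all_countable) (auto intro: AE_not_in)
  then show ?thesis
  proof (rule AE_mp, intro AE_I2 impI)
    fix x assume *: "\<forall>n. x \<notin> S n" and "x \<in> E"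
    show "g x \<le> c"
    proof (rule ccontr)
      assume "\<not> g x \<le> c"
      then obtain n where "1 / real (Suc n) < g x - c"
        using nat_approx_posE[of "g x - c"] by auto
      then have "x \<in> S n"
        using \<open>x \<in> E\<close> E(2) by (auto simp: S_def)
      then show False using * by blast
    qed
  qed
qed

text \<open>The cubes in \<open>F\<close> are the maximal ones with average above \<open>c\<close>.
  Their parents were not selected and have \<open>2 ^ DIM('a)\<close> times the volume, which gives
  the upper bound on averages. Off the union all averages are at most \<open>c\<close>, so
  differentiation applies. Summing the lower bound \<open>c < avg R g\<close> yields the measure
  estimate.\<close>

lemma dyadic_Calderon_Zygmund:
  fixes a :: "'a::euclidean_space"
  assumes l: "0 < l" and Q: "Q = dcube a l k x0" and g: "set_integrable lebesgue Q g" "\<And>x. 0 \<le> g x"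
    and c: "0 < c" "avg Q g \<le> c"
  obtains F where "countable F" "disjoint F"
    "\<And>R. R \<in> F \<Longrightarrow> R \<subseteq> Q \<and> (\<exists>x\<in>Q. \<exists>j\<ge>k. R = dcube a l j x) \<and> avg R g \<le> 2 ^ DIM('a) * c"
    "AE x\<in>Q - \<Union>F in lebesgue. g x \<le> c"
    "c * measure lebesgue (\<Union>F) \<le> avg Q g * measure lebesgue Q"
proof -
  let ?S = "{x \<in> Q. \<exists>j\<ge>k. c < avg (dcube a l j x) g}"
  obtain F where F: "countable F" "disjoint F" "?S \<subseteq> \<Union>F"
    and "\<forall>R\<in>F. c < avg R g \<and> (\<exists>x\<in>?S. \<exists>j\<ge>k. R = dcube a l j x \<and>
       (\<forall>i. k \<le> i \<and> i < j \<longrightarrow> \<not> c < avg (dcube a l i x) g))"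
    by (rule dcube_stopping[where P = "\<lambda>R. c < avg R g" and S = ?S, OF l]) blast
  note FR = bspec[OF this(4)]
  have QL: "Q \<in> lmeasurable" using Q l by simp
  have sub: "dcube a l j x \<subseteq> Q" if "x \<in> Q" "k \<le> j" for x j
    using that Q dcube_eq[of x a l k x0] dcube_antimono[of k j a l x] by auto
  have R1: "R \<subseteq> Q \<and> (\<exists>x\<in>Q. \<exists>j\<ge>k. R = dcube a l j x) \<and> avg R g \<le> 2 ^ DIM('a) * c" if "R \<in> F" for R
  proof -
    from FR[OF that] obtain x j where R: "c < avg R g" "x \<in> Q" "k \<le> j" "R = dcube a l j x"
      and stop: "\<And>i. k \<le> i \<Longrightarrow> i < j \<Longrightarrow> avg (dcube a l i x) g \<le> c" by fastforce
    have "dcube a l k x = Q" using Q R(2) dcube_eq by blast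
    \<comment> \<open>As \<open>Q\<close> itself has average at most \<open>c\<close>, it is not
      selected. So \<open>R\<close> has a parent of generation at least \<open>k\<close>, which
      still lies in \<open>Q\<close>.\<close>
    then have "j \<noteq> k" using R(1,4) c(2) by auto
    then obtain i where i: "j = Suc i" "k \<le> i" using R(3) by (cases j) auto
    let ?P = "dcube a l i x"
    have P: "avg ?P g \<le> c" using stop i by simp
    have RP: "R \<subseteq> ?P" using R(4) i dcube_antimono[of i j a l x] by simp
    have "(l / 2 ^ i) ^ DIM('a) = 2 ^ DIM('a) * (l / 2 ^ j) ^ DIM('a)"
      using i by (simp flip: power_mult_distrib)
    then have mP: "measure lebesgue ?P = 2 ^ DIM('a) * measure lebesgue R"
      using R(4) by (simp add: measure_dcube[OF l])
    have "ennreal (avg R g) * emeasure lebesgue R = (\<integral>\<^sup>+y\<in>R. ennreal (g y) \<partial>lebesgue)"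
      using set_nn_integral_dcube_avg[OF l g sub[OF R(2,3)]] R(4) by simp
    also have "\<dots> \<le> (\<integral>\<^sup>+y\<in>?P. ennreal (g y) \<partial>lebesgue)"
      using RP by (intro nn_integral_mono) (auto simp: indicator_def)
    also have "\<dots> = ennreal (avg ?P g) * emeasure lebesgue ?P"
      using set_nn_integral_dcube_avg[OF l g sub[OF R(2) i(2)]] .
    finally have "ennreal (avg R g * measure lebesgue R) \<le> ennreal (avg ?P g * measure lebesgue ?P)"
      using R(4) l g(2) by (simp add: emeasure_eq_measure2 ennreal_mult avg_nonneg)
    then have "avg R g * measure lebesgue R \<le> avg ?P g * measure lebesgue ?P"
      using g(2) by (subst (asm) ennreal_le_iff) (auto intro!: mult_nonneg_nonneg avg_nonneg)
    also have "\<dots> \<le> c * (2 ^ DIM('a) * measure lebesgue R)"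
      unfolding mP using P by (intro mult_right_mono) auto
    finally have "avg R g \<le> 2 ^ DIM('a) * c"
      using measure_dcube_pos[OF l, of a j x] R(4) by (simp add: mult_ac flip: mult.assoc)
    then show ?thesis using R sub by blast
  qed
  have RL: "R \<in> sets lebesgue" if "R \<in> F" for R
    using R1[OF that] l by (auto intro: fmeasurableD)
  then have UL: "\<Union>F \<in> sets lebesgue" using F(1) by (intro sets.countable_Union) auto
  have UQ: "\<Union>F \<subseteq> Q" using R1 by blast
  have UL': "\<Union>F \<in> lmeasurable" using fmeasurableI2[OF QL UQ UL] .
  have "AE x\<in>Q - \<Union>F in lebesgue. g x \<le> c"
  proof (rule AE_le_if_dcube_avg_le[OF l Q g])
    show "avg (dcube a l j x) g \<le> c" if "x \<in> Q - \<Union>F" "k \<le> j" for x j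
      using that F(3) by fastforce
  qed (use QL UL c in \<open>auto intro: fmeasurableD\<close>)
  moreover have "c * measure lebesgue (\<Union>F) \<le> avg Q g * measure lebesgue Q"
  proof -
    define G where "G = density lebesgue (\<lambda>x. ennreal (indicator Q x * g x))"
    have GR: "emeasure G R = (\<integral>\<^sup>+x\<in>R. ennreal (g x) \<partial>lebesgue)" if "R \<subseteq> Q" "R \<in> sets lebesgue" for R
      unfolding G_def using emeasure_density_indicator_mult[OF set_integrable_imp_measurable[OF g(1)] that] .
    have "emeasure lebesgue R \<le> ennreal (1 / c) * emeasure G R" if "R \<in> F" for R
    proof -
      from FR[OF that] obtain x j where R: "c < avg R g" "x \<in> Q" "k \<le> j" "R = dcube a l j x"
        by blast
      have "emeasure lebesgue R = ennreal (1 / c) * (ennreal c * emeasure lebesgue R)"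
        using c by (simp flip: mult.assoc ennreal_mult)
      also have "\<dots> \<le> ennreal (1 / c) * (ennreal (avg R g) * emeasure lebesgue R)"
        using R(1) by (intro mult_left_mono mult_right_mono ennreal_leI) auto
      also have "ennreal (avg R g) * emeasure lebesgue R = emeasure G R"
        using set_nn_integral_dcube_avg[OF l g sub[OF R(2,3)]] R1[OF that] RL[OF that] R(4) by (simp add: GR)
      finally show ?thesis .
    qed
    then have "emeasure lebesgue (\<Union>F) \<le> ennreal (1 / c) * emeasure G (\<Union>F)"
      using RL by (intro emeasure_Union_le_mult F) (simp_all add: G_def subset_iff)
    also have "\<dots> \<le> ennreal (1 / c) * emeasure G Q"
      using UQ QL by (intro mult_left_mono emeasure_mono) (auto simp: G_def intro: fmeasurableD)
    also have "emeasure G Q = ennreal (avg Q g * measure lebesgue Q)"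
      using QL g Q measure_dcube_pos[OF l, of a k x0]
      by (subst GR) (auto intro!: set_nn_integral_eq_avg fmeasurableD)
    finally have "ennreal (measure lebesgue (\<Union>F)) \<le> ennreal (1 / c * (avg Q g * measure lebesgue Q))"
      using UL' c by (simp add: emeasure_eq_measure2 flip: ennreal_mult')
    then have "measure lebesgue (\<Union>F) \<le> 1 / c * (avg Q g * measure lebesgue Q)"
      using c g(2) by (subst (asm) ennreal_le_iff) (auto intro!: mult_nonneg_nonneg divide_nonneg_nonneg avg_nonneg)
    then show ?thesis using c by (simp add: field_simps)
  qed
  ultimately show ?thesis using that F R1 by blast
qed

section \<open>Powers and averages\<close>

text \<open>Convexity of the \<open>p\<close>-th power, applied to \<open>x + y\<close> written as
  the convex combination of \<open>x / (1 - t)\<close> and \<open>y / t\<close>. Only the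
  coefficient of \<open>x powr p\<close> must stay moderate in the iteration, which is why the split
  is asymmetric; it is used with \<open>t = 1 / 4\<close>.\<close>

lemma powr_add_le:
  fixes x y p t :: real
  assumes "1 \<le> p" "0 \<le> x" "0 \<le> y" "0 < t" "t < 1"
  shows "(x + y) powr p \<le> (1 - t) powr (1 - p) * x powr p + t powr (1 - p) * y powr p"
proof -
  \<comment> \<open>Both coefficients are at least 1, which settles the cases where \<open>x\<close>
    or \<open>y\<close> is 0.\<close>
  have ge1: "1 \<le> s powr (1 - p)" if "0 < s" "s < 1" for s :: real
    using powr_mono'[of "1 - p" 0 s] that assms(1) by simp
  consider "x = 0" | "y = 0" | "0 < x" "0 < y" using assms by linarith
  then show ?thesis
  proof cases
    case 1
    then show ?thesis using mult_right_mono[OF ge1[of t], of "y powr p"] assms by simp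
  next
    case 2
    then show ?thesis using mult_right_mono[OF ge1[of "1 - t"], of "x powr p"] assms by simp
  next
    case 3
    have scale: "s * (z / s) powr p = s powr (1 - p) * z powr p" if "0 < s" "0 < z" for s z :: real
      using that by (simp add: powr_divide powr_diff)
    have "(x + y) powr p = ((1 - t) *\<^sub>R (x / (1 - t)) + t *\<^sub>R (y / t)) powr p"
      using assms by simp
    also have "\<dots> \<le> (1 - t) * (x / (1 - t)) powr p + t * (y / t) powr p"
      using assms 3 by (intro convex_onD[OF powr_convex]) auto
    finally show ?thesis
      using assms 3 by (simp add: scale)
  qed
qed

lemma avg_mono:
  assumes "set_integrable lebesgue Q f" "set_integrable lebesgue Q g" "AE x\<in>Q in lebesgue. f x \<le> g x"
  shows "avg Q f \<le> avg Q g"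
  unfolding avg_def using assms by (intro mult_left_mono set_integral_mono_AE) auto

lemma avg_cong:
  assumes "AE x\<in>Q in lebesgue. f x = g x" "set_borel_measurable lebesgue Q f" "set_borel_measurable lebesgue Q g"
  shows "avg Q f = avg Q g"
  unfolding avg_def set_lebesgue_integral_def using assms(2,3) unfolding set_borel_measurable_def
  by (intro arg_cong2[where f = "(*)"] integral_cong_AE) (use assms(1) in \<open>auto simp: indicator_def elim: AE_mp\<close>)

lemma avg_add:
  assumes "set_integrable lebesgue Q f" "set_integrable lebesgue Q g"
  shows "avg Q (\<lambda>x. f x + g x) = avg Q f + avg Q g"
  unfolding avg_def using assms by (simp add: set_integral_add algebra_simps)

lemma avg_le_const:
  assumes "set_integrable lebesgue Q f" "AE x\<in>Q in lebesgue. f x \<le> c" "Q \<in> lmeasurable" "0 < measure lebesgue Q"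
  shows "avg Q f \<le> c"
proof -
  have "set_integrable lebesgue Q (\<lambda>x. c)"
    using assms(3) by (auto simp: set_integrable_def fmeasurable_def)
  then have "avg Q f \<le> avg Q (\<lambda>x. c)"
    using assms by (intro avg_mono)
  also have "\<dots> = c"
    using assms(3,4) by (simp add: avg_def set_lebesgue_integral_def fmeasurableD)
  finally show ?thesis .
qed

text \<open>A finite bound on the nonnegative integral also supplies the integrability that
  \<open>Lp_avg_le\<close> asserts separately.\<close>

lemma Lp_avg_leI:
  assumes "set_borel_measurable lebesgue Q g" "Q \<in> lmeasurable" "0 < measure lebesgue Q" "0 < p" "0 \<le> c"
    and "(\<integral>\<^sup>+x\<in>Q. ennreal (g x powr p) \<partial>lebesgue) \<le> ennreal (c powr p) * emeasure lebesgue Q"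
  shows "Lp_avg_le p Q g c"
proof -
  have "(\<lambda>x. indicator Q x * (indicator Q x * g x) powr p) \<in> borel_measurable lebesgue"
    using assms(1) fmeasurableD[OF assms(2)] unfolding set_borel_measurable_def real_scaleR_def
    by measurable
  also have "(\<lambda>x. indicator Q x * (indicator Q x * g x) powr p) = (\<lambda>x. indicator Q x * g x powr p)"
    by (auto simp: indicator_def)
  finally have m: "(\<lambda>x. indicator Q x * g x powr p) \<in> borel_measurable lebesgue" .
  have eq: "(\<integral>\<^sup>+x. ennreal (indicator Q x * g x powr p) \<partial>lebesgue) = (\<integral>\<^sup>+x\<in>Q. ennreal (g x powr p) \<partial>lebesgue)"
    by (intro nn_integral_cong) (auto simp: indicator_def)
  have fin: "emeasure lebesgue Q = ennreal (measure lebesgue Q)"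
    using assms(2) by (simp add: emeasure_eq_measure2)
  have int: "set_integrable lebesgue Q (\<lambda>x. g x powr p)"
    unfolding set_integrable_def real_scaleR_def using m assms(6)
    by (intro integrableI_nonneg) (auto simp: eq fin top_unique ennreal_mult_less_top intro: le_less_trans)
  then have "ennreal (avg Q (\<lambda>x. g x powr p) * measure lebesgue Q) \<le> ennreal (c powr p * measure lebesgue Q)"
    using assms(3,6) set_nn_integral_eq_avg[OF int] by (simp add: fin ennreal_mult)
  then have "avg Q (\<lambda>x. g x powr p) \<le> c powr p"
    using assms(3) by (subst (asm) ennreal_le_iff) auto
  then have "avg Q (\<lambda>x. g x powr p) powr (1 / p) \<le> (c powr p) powr (1 / p)"
    using assms(4) by (intro powr_mono2) (auto intro: avg_nonneg)
  also have "\<dots> = c"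
    using assms(4,5) by (simp add: powr_powr)
  finally show ?thesis
    using int by (simp add: Lp_avg_le_def)
qed

section \<open>Gurov--Reshetnyak weights\<close>

text \<open>Corner and side length of the cube are fixed here so that \<open>dcube a l k x\<close>
  refers to one definite grid.\<close>

locale gurov_reshetnyak_weight =
  fixes a :: "'a::euclidean_space" and l :: real
    and B :: "'a set \<Rightarrow> ('a \<Rightarrow> 'b::{real_normed_field,banach,second_countable_topology}) \<Rightarrow> 'a \<Rightarrow> 'b"
    and CB \<epsilon> :: real and w :: "'a \<Rightarrow> real"
  assumes l: "0 < l" and CB: "0 < CB" and eps: "0 < \<epsilon>" "\<epsilon> < 1"
    and osc: "local_oscillation (cube a l) B CB"
    and GR: "w \<in> GR_dyadic B \<epsilon> (cube a l)"
begin

abbreviation "Q0 \<equiv> cube a l"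
abbreviation "W \<equiv> (\<lambda>y. of_real (w y) :: 'b)"
abbreviation "A \<equiv> compl_op B"
abbreviation "oscn \<equiv> (\<lambda>Q x. norm (B Q W x))"
abbreviation "appr \<equiv> (\<lambda>Q. avg Q (\<lambda>x. norm (A Q W x)))"

section \<open>Direct consequences of the hypotheses on the oscillation and the weight\<close>

lemma dyadic_dcube: "x \<in> Q0 \<Longrightarrow> dcube a l k x \<in> dyadic_subcubes Q0"
  using dcube_in_dyadic_subcubes[OF l] .

lemma dyadic_lmeasurable:
  assumes "Q \<in> dyadic_subcubes Q0"
  shows "Q \<in> lmeasurable" "0 < measure lebesgue Q" "Q \<subseteq> Q0"
proof -
  \<comment> \<open>The corner and side obtained here are not identified with \<open>a\<close> and
    \<open>l\<close>; the three conclusions do not mention them.\<close>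
  obtain a' l' k x where Q: "0 < l'" "Q0 = cube a' l'" "x \<in> Q0" "Q = dcube a' l' k x"
    using dyadic_subcubeE[OF assms] .
  then show "Q \<in> lmeasurable" "0 < measure lebesgue Q" "Q \<subseteq> Q0"
    using measure_dcube_pos[OF Q(1)] dcube_subset_cube[OF Q(1), of x a' k] by auto
qed

lemma w_integrable: "set_integrable lebesgue Q0 w"
  and w_nonneg: "AE x\<in>Q0 in lebesgue. 0 \<le> w x"
  and GR_avg: "Q \<in> dyadic_subcubes Q0 \<Longrightarrow> avg Q (oscn Q) \<le> \<epsilon> * appr Q"
  using GR by (auto simp: GR_dyadic_def)

lemma W_L1: "W \<in> L1_on Q0"
proof -
  have "integrable lebesgue (\<lambda>x. of_real (indicator Q0 x *\<^sub>R w x) :: 'b)"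
    using w_integrable unfolding set_integrable_def by (rule integrable_of_real)
  then show ?thesis
    unfolding L1_on_def set_integrable_def by (simp add: scaleR_conv_of_real)
qed

lemma A_L1: "Q \<in> dyadic_subcubes Q0 \<Longrightarrow> f \<in> L1_on Q0 \<Longrightarrow> A Q f \<in> L1_on Q0"
  using osc by (simp add: local_oscillation_def linear_operator_L1_def Let_def)

lemma A_bound: "Q \<in> dyadic_subcubes Q0 \<Longrightarrow> f \<in> L1_on Q0 \<Longrightarrow>
    AE x\<in>Q in lebesgue. norm (A Q f x) \<le> CB * avg Q (\<lambda>y. norm (f y))"
  using osc by (simp add: local_oscillation_def Let_def)

lemma A_add: "Q \<in> dyadic_subcubes Q0 \<Longrightarrow> f \<in> L1_on Q0 \<Longrightarrow> g \<in> L1_on Q0 \<Longrightarrow>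
    AE x\<in>Q0 in lebesgue. A Q (\<lambda>y. f y + g y) x = A Q f x + A Q g x"
  using osc by (simp add: local_oscillation_def linear_operator_L1_def Let_def)

lemma B_A: "R \<in> dyadic_subcubes Q0 \<Longrightarrow> Q \<in> dyadic_subcubes Q0 \<Longrightarrow> R \<subseteq> Q \<Longrightarrow> f \<in> L1_on Q0 \<Longrightarrow>
    AE x\<in>R in lebesgue. B R (A Q f) x = 0"
  using osc by (simp add: local_oscillation_def Let_def)

lemma B_L1:
  assumes "Q \<in> dyadic_subcubes Q0" "f \<in> L1_on Q0" shows "B Q f \<in> L1_on Q0"
proof -
  have "(\<lambda>x. f x - A Q f x) \<in> L1_on Q0"
    using A_L1[OF assms] assms(2) by (simp add: L1_on_def)
  then show ?thesis by (simp add: compl_op_def)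
qed

lemma L1_norm_integrable:
  assumes "f \<in> L1_on Q0" "Q \<in> dyadic_subcubes Q0"
  shows "set_integrable lebesgue Q (\<lambda>x. norm (f x))"
proof -
  have "set_integrable lebesgue Q f"
    using assms(1) dyadic_lmeasurable[OF assms(2)] unfolding L1_on_def
    by (auto intro: set_integrable_subset fmeasurableD)
  then show ?thesis by (rule set_integrable_norm)
qed

lemma oscn_integrable:
  "R \<in> dyadic_subcubes Q0 \<Longrightarrow> Q \<in> dyadic_subcubes Q0 \<Longrightarrow> set_integrable lebesgue R (oscn Q)"
  by (intro L1_norm_integrable B_L1 W_L1)

lemma appr_integrable:
  "R \<in> dyadic_subcubes Q0 \<Longrightarrow> Q \<in> dyadic_subcubes Q0 \<Longrightarrow> set_integrable lebesgue R (\<lambda>x. norm (A Q W x))"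
  by (intro L1_norm_integrable A_L1 W_L1)

lemma appr_nonneg: "0 \<le> appr Q"
  by (intro avg_nonneg) auto

lemma w_integrable_sub: "Q \<in> dyadic_subcubes Q0 \<Longrightarrow> set_integrable lebesgue Q w"
  using dyadic_lmeasurable by (auto intro!: set_integrable_subset[OF w_integrable] fmeasurableD)

lemma w_nonneg_sub: "Q \<in> dyadic_subcubes Q0 \<Longrightarrow> AE x\<in>Q in lebesgue. 0 \<le> w x"
  using w_nonneg dyadic_lmeasurable(3) by (auto elim: AE_mp)

lemma avg_abs_w:
  assumes "Q \<in> dyadic_subcubes Q0" shows "avg Q (\<lambda>x. \<bar>w x\<bar>) = avg Q w"
proof (rule avg_cong)
  show "AE x\<in>Q in lebesgue. \<bar>w x\<bar> = w x"
    using w_nonneg_sub[OF assms] by (auto elim: AE_mp)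
qed (use set_integrable_abs w_integrable_sub[OF assms] in \<open>auto intro: set_integrable_imp_measurable\<close>)

text \<open>Triangle inequality for the splitting of \<open>W\<close> into \<open>A Q W\<close> and
  \<open>B Q W\<close>, the second term being absorbed by the Gurov--Reshetnyak condition. Together
  with \<open>appr_le\<close> it makes \<open>appr Q\<close> and \<open>avg Q w\<close>
  comparable.\<close>

lemma avg_w_le:
  assumes "Q \<in> dyadic_subcubes Q0" shows "avg Q w \<le> (1 + \<epsilon>) * appr Q"
proof -
  have "norm (W x) \<le> norm (A Q W x) + norm (B Q W x)" for x
    using norm_triangle_ineq[of "A Q W x" "B Q W x"] by (simp add: compl_op_def)
  then have "avg Q (\<lambda>x. norm (W x)) \<le> avg Q (\<lambda>x. norm (A Q W x) + norm (B Q W x))"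
    using assms by (intro avg_mono L1_norm_integrable[OF W_L1] set_integral_add appr_integrable oscn_integrable) auto
  also have "\<dots> = appr Q + avg Q (oscn Q)"
    using assms by (intro avg_add appr_integrable oscn_integrable)
  finally show ?thesis
    using GR_avg[OF assms] by (simp add: avg_abs_w[OF assms] algebra_simps)
qed

lemma appr_le:
  assumes "Q \<in> dyadic_subcubes Q0" shows "appr Q \<le> CB * avg Q w"
  using A_bound[OF assms W_L1] dyadic_lmeasurable[OF assms] assms
  by (intro avg_le_const appr_integrable) (auto simp: avg_abs_w[OF assms])

text \<open>Applying \<open>A R\<close> to the splitting of \<open>W\<close> on \<open>Q\<close>
  leaves \<open>A Q W\<close> unchanged on \<open>R\<close>, so passing from \<open>Q\<close> to
  \<open>R\<close> costs only the term \<open>A R (B Q W)\<close>, bounded in supremum by the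
  average of \<open>oscn Q\<close> over \<open>R\<close>. For the second estimate
  \<open>A Q W\<close> must be bounded pointwise, because its average over \<open>Q\<close> does not
  control its average over a small \<open>R\<close>.\<close>

lemma subcube_estimates:
  assumes Q: "Q \<in> dyadic_subcubes Q0" and R: "R \<in> dyadic_subcubes Q0" "R \<subseteq> Q"
  shows "AE x\<in>R in lebesgue. oscn Q x \<le> oscn R x + CB * avg R (oscn Q)"
    and "appr R \<le> CB * (1 + \<epsilon>) * appr Q + CB * avg R (oscn Q)"
proof -
  have W: "(\<lambda>y. A Q W y + B Q W y) = W" by (simp add: compl_op_def)
  have split: "AE x\<in>R in lebesgue. A R W x = A R (A Q W) x + A R (B Q W) x"
    using A_add[OF R(1) A_L1[OF Q W_L1] B_L1[OF Q W_L1]] dyadic_lmeasurable(3)[OF R(1)]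
    unfolding W by (auto elim: AE_mp)
  have idem: "AE x\<in>R in lebesgue. A R (A Q W) x = A Q W x"
    using B_A[OF R(1) Q R(2) W_L1] by (auto simp: compl_op_def elim: AE_mp)
  have small: "AE x\<in>R in lebesgue. norm (A R (B Q W) x) \<le> CB * avg R (oscn Q)"
    using A_bound[OF R(1) B_L1[OF Q W_L1]] .
  have "AE x\<in>Q in lebesgue. norm (A Q W x) \<le> CB * avg Q w"
    using A_bound[OF Q W_L1] by (simp add: avg_abs_w[OF Q])
  then have main: "AE x\<in>R in lebesgue. norm (A Q W x) \<le> CB * avg Q w"
    using R(2) by (auto elim: AE_mp)
  show "AE x\<in>R in lebesgue. oscn Q x \<le> oscn R x + CB * avg R (oscn Q)"
    using split idem small
  proof eventually_elim
    case (elim x)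
    show ?case
    proof
      assume "x \<in> R"
      with elim have "B Q W x = B R W x + A R (B Q W) x" "norm (A R (B Q W) x) \<le> CB * avg R (oscn Q)"
        by (auto simp: compl_op_def algebra_simps)
      then show "oscn Q x \<le> oscn R x + CB * avg R (oscn Q)"
        using norm_triangle_ineq[of "B R W x" "A R (B Q W) x"] by simp
    qed
  qed
  have "AE x\<in>R in lebesgue. norm (A R W x) \<le> CB * avg Q w + CB * avg R (oscn Q)"
    using split idem small main
  proof eventually_elim
    case (elim x)
    show ?case
    proof
      assume "x \<in> R"
      with elim have "A R W x = A Q W x + A R (B Q W) x" "norm (A R (B Q W) x) \<le> CB * avg R (oscn Q)"
        "norm (A Q W x) \<le> CB * avg Q w"
        by auto
      then show "norm (A R W x) \<le> CB * avg Q w + CB * avg R (oscn Q)"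
        using norm_triangle_ineq[of "A Q W x" "A R (B Q W) x"] by simp
    qed
  qed
  then have "appr R \<le> CB * avg Q w + CB * avg R (oscn Q)"
    using dyadic_lmeasurable[OF R(1)] R(1) by (intro avg_le_const appr_integrable)
  also have "CB * avg Q w \<le> CB * ((1 + \<epsilon>) * appr Q)"
    using CB avg_w_le[OF Q] by (intro mult_left_mono) auto
  finally show "appr R \<le> CB * (1 + \<epsilon>) * appr Q + CB * avg R (oscn Q)"
    by (simp add: mult.assoc)
qed

lemma oscn_truncated_measurable:
  assumes "R \<in> dyadic_subcubes Q0" "Q \<in> dyadic_subcubes Q0"
  shows "set_borel_measurable lebesgue R (\<lambda>x. min (oscn Q x) N powr p)"
proof -
  have "(\<lambda>x. indicator R x *\<^sub>R oscn Q x) \<in> borel_measurable lebesgue"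
    using set_integrable_imp_measurable[OF oscn_integrable[OF assms]] by (simp add: set_borel_measurable_def)
  then have "(\<lambda>x. indicator R x * min (indicator R x *\<^sub>R oscn Q x) N powr p) \<in> borel_measurable lebesgue"
    using fmeasurableD[OF dyadic_lmeasurable(1)[OF assms(1)]] by measurable
  also have "(\<lambda>x. indicator R x * min (indicator R x *\<^sub>R oscn Q x) N powr p)
      = (\<lambda>x. indicator R x * min (oscn Q x) N powr p)"
    by (auto simp: indicator_def)
  finally show ?thesis by (simp add: set_borel_measurable_def)
qed

text \<open>Handles the degenerate case of the iteration: the stopping height is a multiple of
  \<open>appr Q\<close>, and the decomposition requires a positive height.\<close>

lemma oscn_eq_0:
  assumes "Q \<in> dyadic_subcubes Q0" "appr Q = 0"
  shows "AE x\<in>Q in lebesgue. oscn Q x = 0"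
proof -
  have "avg Q (oscn Q) = 0"
    using GR_avg[OF assms(1)] assms(2) by (simp add: antisym avg_nonneg)
  then have "integral\<^sup>L lebesgue (\<lambda>x. indicator Q x *\<^sub>R oscn Q x) = 0"
    using dyadic_lmeasurable(2)[OF assms(1)] by (simp add: avg_def set_lebesgue_integral_def)
  then have "AE x in lebesgue. indicator Q x *\<^sub>R oscn Q x = 0"
    using oscn_integrable[OF assms(1,1)] unfolding set_integrable_def
    by (subst (asm) integral_nonneg_eq_0_iff_AE) auto
  then show ?thesis by eventually_elim (auto simp: indicator_def)
qed

end

section \<open>Iteration\<close>

text \<open>\<open>K\<close> is the stopping height in units of \<open>\<epsilon> * appr Q\<close>,
  and \<open>L\<close> times the height bounds \<open>A R (B Q W)\<close> on a selected cube.
  \<open>D\<close> is chosen so that the terms newly produced in one step amount to at most a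
  quarter of it, while the iterated terms use three quarters.\<close>

locale small_gurov_reshetnyak_weight = gurov_reshetnyak_weight +
  fixes p M L K D :: real
  assumes p: "1 \<le> p"
    and small: "L * \<epsilon> * (4 * M) powr (p - 1) \<le> 1 / 4"
    and M_def: "M = max 1 CB" and L_def: "L = CB * 2 ^ DIM('a)" and K_def: "K = (4 * M) powr p"
    and D_def: "D = 4 * (K powr p * (1 + (1 / 4) powr (1 - p) * L powr p))"
begin

lemma const_bounds: "1 \<le> M" "CB \<le> M" "0 < L" "1 \<le> K" "0 < D"
proof -
  show M: "1 \<le> M" "CB \<le> M" and L: "0 < L" using CB by (auto simp: M_def L_def)
  have "1 powr p \<le> (4 * M) powr p" using p M by (intro powr_mono2) auto
  then show K: "1 \<le> K" by (simp add: K_def)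
  have "0 < K powr p" "0 \<le> (1 / 4) powr (1 - p) * L powr p" using K by auto
  then show "0 < D" unfolding D_def by (intro mult_pos_pos add_pos_nonneg) auto
qed

text \<open>The factor \<open>3 * M\<close> is \<open>2 * M\<close>, from
  \<open>CB * (1 + \<epsilon>)\<close>, plus \<open>M\<close>, from
  \<open>L * K * \<epsilon>\<close>. The latter is the smallness assumption rewritten with
  \<open>K = 4 * M * (4 * M) powr (p - 1)\<close>.\<close>

lemma appr_subcube_le:
  assumes "Q \<in> dyadic_subcubes Q0" "R \<in> dyadic_subcubes Q0" "R \<subseteq> Q"
    and "avg R (oscn Q) \<le> 2 ^ DIM('a) * (K * \<epsilon> * appr Q)"
  shows "appr R \<le> 3 * M * appr Q"
proof -
  have "K = 4 * M * (4 * M) powr (p - 1)"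
    using const_bounds(1) by (simp add: K_def powr_diff)
  then have "L * K * \<epsilon> = 4 * M * (L * \<epsilon> * (4 * M) powr (p - 1))"
    by (simp add: mult_ac)
  also have "\<dots> \<le> 4 * M * (1 / 4)"
    using small const_bounds by (intro mult_left_mono) auto
  finally have *: "L * K * \<epsilon> \<le> M" by simp
  have "CB * (1 + \<epsilon>) \<le> M * 2"
    using eps CB const_bounds by (intro mult_mono) auto
  with * have **: "(CB * (1 + \<epsilon>) + L * K * \<epsilon>) * appr Q \<le> 3 * M * appr Q"
    by (intro mult_right_mono appr_nonneg) auto
  have "CB * avg R (oscn Q) \<le> CB * (2 ^ DIM('a) * (K * \<epsilon> * appr Q))"
    using assms(4) CB by (intro mult_left_mono) auto
  also have "\<dots> = L * K * \<epsilon> * appr Q" by (simp add: L_def)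
  finally show ?thesis
    using subcube_estimates(2)[OF assms(1-3)] ** by (simp add: algebra_simps)
qed

text \<open>One step of the iteration in numbers: the first summand comes from the points off the
  selected cubes, the second from the selected cubes, of relative measure at most
  \<open>1 / K\<close>. The parameter \<open>t = 1 / 4\<close> in \<open>powr_add_le\<close> is
  matched to the ratio \<open>3 * M / (4 * M)\<close>, so that the powers of 3/4 combine to the
  contraction factor 3/4.\<close>

lemma recursion_constants:
  fixes e N :: real and m :: nat
  assumes "0 \<le> e" "0 \<le> N"
  shows "(K * e) powr p + ((3 / 4) powr (1 - p) * (D * (3 * M * e) powr p + N powr p * (1 / 4) ^ m)
      + (1 / 4) powr (1 - p) * (L * (K * e)) powr p) / K
    \<le> D * e powr p + N powr p * (1 / 4) ^ Suc m"
proof -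
  have Kpos: "0 < K" using const_bounds by simp
  have "(3 / 4) powr (1 - p) * (D * (3 * M * e) powr p) / K
      = D * e powr p * ((3 / 4) powr (1 - p) * ((3 * M) powr p / (4 * M) powr p))"
    using assms const_bounds by (simp add: powr_mult K_def mult_ac)
  also have "(3 * M) powr p / (4 * M) powr p = (3 / 4) powr p"
    using const_bounds by (simp flip: powr_divide)
  also have "(3 / 4) powr (1 - p) * (3 / 4) powr p = (3 / 4 :: real)"
    by (simp flip: powr_add)
  finally have 1: "(3 / 4) powr (1 - p) * (D * (3 * M * e) powr p) / K = 3 / 4 * (D * e powr p)"
    by simp
  \<comment> \<open>The truncation term must shrink by 1/4 per step; this holds as
    \<open>(4 / 3) powr (p - 1)\<close> is at most \<open>(4 * M) powr (p - 1)\<close>, hence at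
    most \<open>K / 4\<close>.\<close>
  have "(3 / 4) powr (1 - p) = (4 / 3 :: real) powr (p - 1)"
    using powr_divide[of 1 "4 / 3 :: real" "p - 1"] powr_minus_divide[of "3/4::real" "p - 1"]
      powr_divide[of 3 4 "p - 1"] powr_divide[of 4 3 "p - 1"] by simp
  also have "\<dots> \<le> (4 * M) powr (p - 1)"
    using p const_bounds by (intro powr_mono2) auto
  also have "\<dots> = K / (4 * M)"
    using const_bounds by (simp add: K_def powr_diff)
  also have "\<dots> \<le> K / 4"
    using const_bounds Kpos by (intro divide_left_mono) auto
  finally have "(3 / 4) powr (1 - p) / K \<le> 1 / 4"
    using Kpos by (simp add: field_simps)
  then have "(3 / 4) powr (1 - p) / K * (N powr p * (1 / 4) ^ m) \<le> 1 / 4 * (N powr p * (1 / 4) ^ m)"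
    by (intro mult_right_mono) auto
  then have 2: "(3 / 4) powr (1 - p) * (N powr p * (1 / 4) ^ m) / K \<le> N powr p * (1 / 4) ^ Suc m"
    by simp
  \<comment> \<open>Dropping the division by \<open>K\<close>, which is at least 1, makes the
    remaining terms exactly a quarter of \<open>D * e powr p\<close>.\<close>
  have "(1 / 4) powr (1 - p) * (L * (K * e)) powr p / K \<le> (1 / 4) powr (1 - p) * (L * (K * e)) powr p / 1"
    using const_bounds by (intro divide_left_mono) auto
  then have 3: "(K * e) powr p + (1 / 4) powr (1 - p) * (L * (K * e)) powr p / K \<le> 1 / 4 * (D * e powr p)"
    using assms const_bounds by (simp add: D_def powr_mult algebra_simps)
  have linear: "u + (v + x + y) \<le> d + n"
    if "v = 3 / 4 * d" "x \<le> n" "u + y \<le> 1 / 4 * d" for u v x y d n :: real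
    using that by linarith
  show ?thesis
    unfolding distrib_left add_divide_distrib using 1 2 3 by (rule linear)
qed

text \<open>
  Truncation at \<open>N\<close> makes the moments finite a priori, and \<open>N\<^sup>p 4\<^sup>-\<^sup>m\<close> bounds the contribution of
  the cubes reached after \<open>m\<close> stopping steps.
\<close>

lemma truncated_moment_bound:
  assumes x0: "x0 \<in> Q0" and N: "0 \<le> N"
  shows "(\<integral>\<^sup>+x\<in>dcube a l k x0. ennreal (min (oscn (dcube a l k x0) x) N powr p) \<partial>lebesgue)
    \<le> ennreal (D * (\<epsilon> * appr (dcube a l k x0)) powr p + N powr p * (1 / 4) ^ m)
      * emeasure lebesgue (dcube a l k x0)"
  using x0
proof (induction m arbitrary: k x0)
  case 0
  let ?Q = "dcube a l k x0"
  have "(\<integral>\<^sup>+x\<in>?Q. ennreal (min (oscn ?Q x) N powr p) \<partial>lebesgue)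
      \<le> (\<integral>\<^sup>+x\<in>?Q. ennreal (D * (\<epsilon> * appr ?Q) powr p + N powr p) \<partial>lebesgue)"
  proof (intro nn_integral_mono mult_right_mono ennreal_leI)
    fix x
    have "min (oscn ?Q x) N powr p \<le> N powr p" using p N by (intro powr_mono2) auto
    then show "min (oscn ?Q x) N powr p \<le> D * (\<epsilon> * appr ?Q) powr p + N powr p"
      using const_bounds by (simp add: add_increasing)
  qed auto
  also have "\<dots> = ennreal (D * (\<epsilon> * appr ?Q) powr p + N powr p) * emeasure lebesgue ?Q"
    using l by (intro nn_integral_cmult_indicator) (auto intro: fmeasurableD)
  finally show ?case by simp
next
  case (Suc m)
  define Q where "Q = dcube a l k x0"
  define T where "T R x = min (oscn R x) N powr p" for R x
  have QD: "Q \<in> dyadic_subcubes Q0" unfolding Q_def using dyadic_dcube Suc.prems .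
  note QL = dyadic_lmeasurable[OF QD]
  have eQ: "emeasure lebesgue Q = ennreal (measure lebesgue Q)"
    using QL(1) by (simp add: emeasure_eq_measure2)
  define e where "e = \<epsilon> * appr Q"
  have e: "0 \<le> e" using eps appr_nonneg by (simp add: e_def)
  show ?case
  proof (cases "appr Q = 0")
    case True
    have "(\<integral>\<^sup>+x\<in>Q. ennreal (T Q x) \<partial>lebesgue) = (\<integral>\<^sup>+(x::'a). 0 \<partial>lebesgue)"
      using oscn_eq_0[OF QD True] N
      by (intro nn_integral_cong_AE) (auto simp: T_def indicator_def elim: AE_mp)
    then show ?thesis by (simp add: T_def Q_def)
  next
    case False
    then have "0 < e" using eps appr_nonneg[of Q] by (simp add: e_def less_le)
    define c where "c = K * e"
    have c: "0 < c" "e \<le> c" using \<open>0 < e\<close> const_bounds mult_right_mono[of 1 K e] by (auto simp: c_def)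
    have avgQ: "avg Q (oscn Q) \<le> e" using GR_avg[OF QD] by (simp add: e_def)
    obtain F where F: "countable F" "disjoint F"
      and FR: "\<And>R. R \<in> F \<Longrightarrow> R \<subseteq> Q \<and> (\<exists>x\<in>Q. \<exists>j\<ge>k. R = dcube a l j x) \<and> avg R (oscn Q) \<le> 2 ^ DIM('a) * c"
      and off: "AE x\<in>Q - \<Union>F in lebesgue. oscn Q x \<le> c"
      and mF: "c * measure lebesgue (\<Union>F) \<le> avg Q (oscn Q) * measure lebesgue Q"
      by (rule dyadic_Calderon_Zygmund[OF l Q_def oscn_integrable[OF QD QD] norm_ge_zero c(1)
            order_trans[OF avgQ c(2)]]) blast
    have FD: "R \<in> dyadic_subcubes Q0" "R \<subseteq> Q" if "R \<in> F" for R
      using FR[OF that] QL(3) dyadic_dcube by blast+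
    have FL: "R \<in> sets lebesgue" if "R \<in> F" for R
      using dyadic_lmeasurable(1)[OF FD(1)[OF that]] by (rule fmeasurableD)
    have UL: "\<Union>F \<in> sets lebesgue" using F(1) FL by (intro sets.countable_Union) auto
    have UQ: "\<Union>F \<subseteq> Q" using FD by blast
    have UL': "\<Union>F \<in> lmeasurable" using fmeasurableI2[OF QL(1) UQ UL] .
    \<comment> \<open>A bound for the average of \<open>T Q\<close> over every selected cube, from
      \<open>powr_add_le\<close> with \<open>t = 1 / 4\<close>, the induction hypothesis on the
      cube, and \<open>appr_subcube_le\<close>.\<close>
    define c' where "c' = (3 / 4) powr (1 - p) * (D * (3 * M * e) powr p + N powr p * (1 / 4) ^ m)
      + (1 / 4) powr (1 - p) * (L * c) powr p"
    have c': "0 \<le> c'" unfolding c'_def using const_bounds by (intro add_nonneg_nonneg mult_nonneg_nonneg) auto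
    have sub: "(\<integral>\<^sup>+x\<in>R. ennreal (T Q x) \<partial>lebesgue) \<le> ennreal c' * emeasure lebesgue R" if R: "R \<in> F" for R
    proof -
      have avgR: "avg R (oscn Q) \<le> 2 ^ DIM('a) * c" using FR[OF R] by blast
      then have Lc: "CB * avg R (oscn Q) \<le> L * c"
        using CB by (simp add: L_def mult.assoc mult_left_mono)
      have Lc0: "0 \<le> L * c" using const_bounds c by simp
      have "AE x in lebesgue. ennreal (T Q x) * indicator R x
          \<le> ennreal ((3 / 4) powr (1 - p)) * (ennreal (T R x) * indicator R x)
            + ennreal ((1 / 4) powr (1 - p) * (L * c) powr p) * indicator R x"
        using subcube_estimates(1)[OF QD FD[OF R]]
      proof eventually_elim
        case (elim x)
        show ?case
        proof (cases "x \<in> R")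
          case True
          with elim Lc have "oscn Q x \<le> oscn R x + L * c" by force
          \<comment> \<open>Since \<open>L * c\<close> is nonnegative, truncating a sum at
            \<open>N\<close> is at most truncating its first term at \<open>N\<close> and adding the
            second. The level \<open>N\<close> thus stays the same on \<open>R\<close>.\<close>
          then have "T Q x \<le> (min (oscn R x) N + L * c) powr p"
            unfolding T_def using p N Lc0 by (intro powr_mono2) (auto simp: min_def)
          also have "\<dots> \<le> (3 / 4) powr (1 - p) * T R x + (1 / 4) powr (1 - p) * (L * c) powr p"
            using powr_add_le[OF p, of "min (oscn R x) N" "L * c" "1 / 4"] N Lc0 by (simp add: T_def)
          finally show ?thesis
            using True by (simp add: T_def flip: ennreal_mult ennreal_plus)
        qed simp
      qed
      then have "(\<integral>\<^sup>+x\<in>R. ennreal (T Q x) \<partial>lebesgue)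
          \<le> (\<integral>\<^sup>+x. ennreal ((3 / 4) powr (1 - p)) * (ennreal (T R x) * indicator R x)
            + ennreal ((1 / 4) powr (1 - p) * (L * c) powr p) * indicator R x \<partial>lebesgue)"
        by (rule nn_integral_mono_AE)
      also have "\<dots> = ennreal ((3 / 4) powr (1 - p)) * (\<integral>\<^sup>+x\<in>R. ennreal (T R x) \<partial>lebesgue)
          + ennreal ((1 / 4) powr (1 - p) * (L * c) powr p) * emeasure lebesgue R"
      proof -
        have "(\<lambda>x. indicator R x * T R x) \<in> borel_measurable lebesgue"
          using oscn_truncated_measurable[OF FD(1)[OF R] FD(1)[OF R], of N p]
          by (simp add: set_borel_measurable_def T_def)
        then have "(\<lambda>x. ennreal (indicator R x * T R x)) \<in> borel_measurable lebesgue"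
          by measurable
        also have "(\<lambda>x. ennreal (indicator R x * T R x)) = (\<lambda>x. ennreal (T R x) * indicator R x)"
          by (auto simp: indicator_def)
        finally show ?thesis
          using FL[OF R] by (subst nn_integral_add) (auto simp: nn_integral_cmult)
      qed
      also have "\<dots> \<le> ennreal ((3 / 4) powr (1 - p))
            * (ennreal (D * (3 * M * e) powr p + N powr p * (1 / 4) ^ m) * emeasure lebesgue R)
          + ennreal ((1 / 4) powr (1 - p) * (L * c) powr p) * emeasure lebesgue R"
      proof (intro add_right_mono mult_left_mono)
        \<comment> \<open>The induction hypothesis is applied to the oscillation of \<open>R\<close>
          itself, at an arbitrary generation \<open>j\<close>; hence \<open>k\<close> and
          \<open>x0\<close> are generalised in the induction.\<close>
        obtain x j where x: "x \<in> Q" "R = dcube a l j x" using FR[OF R] by blast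
        then have "(\<integral>\<^sup>+x\<in>R. ennreal (T R x) \<partial>lebesgue)
            \<le> ennreal (D * (\<epsilon> * appr R) powr p + N powr p * (1 / 4) ^ m) * emeasure lebesgue R"
          using Suc.IH[of x j] QL(3) by (auto simp: T_def)
        also have "\<dots> \<le> ennreal (D * (3 * M * e) powr p + N powr p * (1 / 4) ^ m) * emeasure lebesgue R"
        proof (intro mult_right_mono ennreal_leI add_right_mono mult_left_mono powr_mono2)
          have "appr R \<le> 3 * M * appr Q"
            using avgR by (intro appr_subcube_le QD FD[OF R]) (simp add: c_def e_def mult_ac)
          then show "\<epsilon> * appr R \<le> 3 * M * e"
            using mult_left_mono[of "appr R" "3 * M * appr Q" \<epsilon>] eps by (simp add: e_def mult_ac)
        qed (use p const_bounds eps appr_nonneg in auto)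
        finally show "(\<integral>\<^sup>+x\<in>R. ennreal (T R x) \<partial>lebesgue)
          \<le> ennreal (D * (3 * M * e) powr p + N powr p * (1 / 4) ^ m) * emeasure lebesgue R" .
      qed auto
      also have "\<dots> = ennreal c' * emeasure lebesgue R"
      proof -
        have "0 \<le> D * (3 * M * e) powr p + N powr p * (1 / 4) ^ m" using const_bounds by simp
        then show ?thesis
          unfolding c'_def by (simp add: ennreal_plus ennreal_mult distrib_right mult.assoc)
      qed
      finally show ?thesis .
    qed
    \<comment> \<open>As a measure, the truncated moment can be split over the selected cubes and
      their complement by additivity.\<close>
    define H where "H = density lebesgue (\<lambda>x. ennreal (indicator Q x * T Q x))"
    have H: "emeasure H R = (\<integral>\<^sup>+x\<in>R. ennreal (T Q x) \<partial>lebesgue)" if "R \<subseteq> Q" "R \<in> sets lebesgue" for R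
      unfolding H_def T_def using emeasure_density_indicator_mult[OF oscn_truncated_measurable[OF QD QD] that] .
    have setsH: "sets H = sets lebesgue" by (simp add: H_def)
    have QS: "Q \<in> sets lebesgue" using QL(1) by (rule fmeasurableD)
    \<comment> \<open>With height \<open>c = K * e\<close> and average at most \<open>e\<close>, the
      decomposition confines the selected cubes to a fraction \<open>1 / K\<close> of
      \<open>Q\<close>.\<close>
    have "c * measure lebesgue (\<Union>F) \<le> e * measure lebesgue Q"
      using mF mult_right_mono[OF avgQ, of "measure lebesgue Q"] by simp
    then have "measure lebesgue (\<Union>F) \<le> measure lebesgue Q / K"
      using \<open>0 < e\<close> const_bounds by (simp add: c_def field_simps)
    then have UK: "emeasure lebesgue (\<Union>F) \<le> ennreal (measure lebesgue Q / K)"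
      using UL' by (simp add: emeasure_eq_measure2 ennreal_leI)
    have HU: "emeasure H (\<Union>F) \<le> ennreal (c' * (measure lebesgue Q / K))"
    proof -
      have "emeasure H (\<Union>F) \<le> ennreal c' * emeasure lebesgue (\<Union>F)"
        using FL FD sub setsH by (intro emeasure_Union_le_mult F) (simp_all add: H subset_iff)
      also have "\<dots> \<le> ennreal c' * ennreal (measure lebesgue Q / K)"
        using UK by (rule mult_left_mono) simp
      finally show ?thesis using c' by (simp flip: ennreal_mult')
    qed
    have HD: "emeasure H (Q - \<Union>F) \<le> ennreal (c powr p * measure lebesgue Q)"
    proof -
      have "emeasure H (Q - \<Union>F) = (\<integral>\<^sup>+x\<in>Q - \<Union>F. ennreal (T Q x) \<partial>lebesgue)"
        using QS UL by (intro H) auto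
      also have "\<dots> \<le> (\<integral>\<^sup>+x. ennreal (c powr p) * indicator Q x \<partial>lebesgue)"
        using off
      proof (intro nn_integral_mono_AE, eventually_elim)
        case (elim x)
        show ?case
        proof (cases "x \<in> Q - \<Union>F")
          case True
          then have "T Q x \<le> c powr p"
            unfolding T_def using elim p N by (intro powr_mono2) auto
          then show ?thesis using True by (auto intro: ennreal_leI)
        qed simp
      qed
      also have "\<dots> = ennreal (c powr p * measure lebesgue Q)"
        using QS by (simp add: nn_integral_cmult_indicator eQ ennreal_mult)
      finally show ?thesis .
    qed
    have "(\<integral>\<^sup>+x\<in>Q. ennreal (T Q x) \<partial>lebesgue) = emeasure H ((Q - \<Union>F) \<union> \<Union>F)"
      using UQ QS H[of Q] by (simp add: Un_absorb2)
    also have "\<dots> = emeasure H (Q - \<Union>F) + emeasure H (\<Union>F)"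
      using QS UL setsH by (intro plus_emeasure[symmetric]) auto
    also have "\<dots> \<le> ennreal (c powr p * measure lebesgue Q) + ennreal (c' * (measure lebesgue Q / K))"
      by (intro add_mono HD HU)
    also have "\<dots> = ennreal ((c powr p + c' / K) * measure lebesgue Q)"
      using c' const_bounds by (subst ennreal_plus[symmetric]) (auto simp: algebra_simps)
    also have "\<dots> \<le> ennreal ((D * e powr p + N powr p * (1 / 4) ^ Suc m) * measure lebesgue Q)"
      using recursion_constants[OF e N, of m] unfolding c'_def c_def
      by (intro ennreal_leI mult_right_mono) auto
    also have "\<dots> = ennreal (D * e powr p + N powr p * (1 / 4) ^ Suc m) * emeasure lebesgue Q"
      using const_bounds by (subst ennreal_mult) (auto simp: eQ)
    finally show ?thesis
      unfolding T_def e_def Q_def .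
  qed
qed

text \<open>Two limits, in this order: for fixed \<open>N\<close> let \<open>m\<close> tend to
  infinity, which removes the term depending on \<open>N\<close>; then let \<open>N\<close> tend to
  infinity by monotone convergence.\<close>

lemma moment_bound:
  assumes Q: "Q = dcube a l k x0" "x0 \<in> Q0"
  shows "(\<integral>\<^sup>+x\<in>Q. ennreal (oscn Q x powr p) \<partial>lebesgue)
    \<le> ennreal (D * (\<epsilon> * appr Q) powr p) * emeasure lebesgue Q"
proof -
  have QD: "Q \<in> dyadic_subcubes Q0" using Q dyadic_dcube by simp
  define T where "T N x = ennreal (min (oscn Q x) (real N) powr p) * indicator Q x" for N :: nat and x
  have eQ: "emeasure lebesgue Q = ennreal (measure lebesgue Q)"
    using dyadic_lmeasurable(1)[OF QD] by (simp add: emeasure_eq_measure2)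
  have T: "integral\<^sup>N lebesgue (T N) \<le> ennreal (D * (\<epsilon> * appr Q) powr p) * emeasure lebesgue Q" for N
  proof -
    have "(\<lambda>m. ennreal ((D * (\<epsilon> * appr Q) powr p + real N powr p * (1 / 4) ^ m) * measure lebesgue Q))
        \<longlonglongrightarrow> ennreal ((D * (\<epsilon> * appr Q) powr p + real N powr p * 0) * measure lebesgue Q)"
      by (intro tendsto_ennrealI tendsto_intros LIMSEQ_realpow_zero) auto
    then have "integral\<^sup>N lebesgue (T N) \<le> ennreal ((D * (\<epsilon> * appr Q) powr p + real N powr p * 0) * measure lebesgue Q)"
    proof (rule LIMSEQ_le_const, intro exI[of _ 0] allI impI)
      fix m :: nat
      show "integral\<^sup>N lebesgue (T N)
          \<le> ennreal ((D * (\<epsilon> * appr Q) powr p + real N powr p * (1 / 4) ^ m) * measure lebesgue Q)"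
        using truncated_moment_bound[OF Q(2), of "real N" k m] const_bounds
        unfolding T_def Q(1)[symmetric] by (simp add: eQ ennreal_mult)
    qed
    then show ?thesis
      using const_bounds by (simp add: eQ ennreal_mult)
  qed
  have Tm: "T N \<in> borel_measurable lebesgue" for N
  proof -
    have "(\<lambda>x. indicator Q x * min (oscn Q x) (real N) powr p) \<in> borel_measurable lebesgue"
      using oscn_truncated_measurable[OF QD QD] by (simp add: set_borel_measurable_def)
    then have "(\<lambda>x. ennreal (indicator Q x * min (oscn Q x) (real N) powr p)) \<in> borel_measurable lebesgue"
      by measurable
    also have "(\<lambda>x. ennreal (indicator Q x * min (oscn Q x) (real N) powr p)) = T N"
      by (auto simp: T_def indicator_def)
    finally show ?thesis .
  qed
  have "incseq T"
    unfolding incseq_def le_fun_def T_def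
    using p by (auto intro!: mult_right_mono ennreal_leI powr_mono2)
  then have "(\<integral>\<^sup>+x. (SUP N. T N x) \<partial>lebesgue) = (SUP N. integral\<^sup>N lebesgue (T N))"
    using Tm by (rule nn_integral_monotone_convergence_SUP)
  also have "\<dots> \<le> ennreal (D * (\<epsilon> * appr Q) powr p) * emeasure lebesgue Q"
    using T by (intro SUP_least)
  finally have *: "(\<integral>\<^sup>+x. (SUP N. T N x) \<partial>lebesgue) \<le> ennreal (D * (\<epsilon> * appr Q) powr p) * emeasure lebesgue Q" .
  have "(\<integral>\<^sup>+x\<in>Q. ennreal (oscn Q x powr p) \<partial>lebesgue) \<le> (\<integral>\<^sup>+x. (SUP N. T N x) \<partial>lebesgue)"
  proof (intro nn_integral_mono)
    fix x
    obtain N :: nat where "oscn Q x \<le> real N" using real_arch_simple by blast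
    then have "ennreal (oscn Q x powr p) * indicator Q x = T N x"
      by (simp add: T_def min_absorb1)
    also have "\<dots> \<le> (SUP N. T N x)" by (rule SUP_upper) simp
    finally show "ennreal (oscn Q x powr p) * indicator Q x \<le> (SUP N. T N x)" .
  qed
  with * show ?thesis by (rule order_trans[rotated])
qed

text \<open>\<open>D\<close> depends on \<open>p\<close>, the dimension and \<open>CB\<close> but
  not on \<open>\<epsilon>\<close>, so \<open>D powr (1 / p)\<close> can serve as a constant chosen
  before \<open>\<epsilon>\<close>.\<close>

lemma Lp_avg_le_oscn:
  assumes Q: "Q = dcube a l k x0" "x0 \<in> Q0"
  shows "Lp_avg_le p Q (oscn Q) (D powr (1 / p) * \<epsilon> * appr Q)"
proof -
  have QD: "Q \<in> dyadic_subcubes Q0" using Q dyadic_dcube by simp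
  have "(D powr (1 / p) * \<epsilon> * appr Q) powr p = D * (\<epsilon> * appr Q) powr p"
    using p const_bounds eps appr_nonneg by (simp add: powr_mult powr_powr)
  then show ?thesis
    using p const_bounds eps appr_nonneg moment_bound[OF Q] dyadic_lmeasurable[OF QD]
    by (intro Lp_avg_leI set_integrable_imp_measurable oscn_integrable QD) (auto intro!: mult_nonneg_nonneg)
qed

text \<open>The weight is at most \<open>oscn Q\<close> plus \<open>norm (A Q W x)\<close>. The
  first part has the moment bound, the second the pointwise bound \<open>CB * avg Q w\<close>. The
  constant involves \<open>\<epsilon>\<close>, which is harmless as \<open>RH_dyadic\<close> allows
  it to depend on the weight.\<close>

lemma Lp_avg_le_w:
  assumes Q: "Q = dcube a l k x0" "x0 \<in> Q0"
  shows "Lp_avg_le p Q w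
    (((3 / 4) powr (1 - p) * (D * (\<epsilon> * CB) powr p) + (1 / 4) powr (1 - p) * CB powr p) powr (1 / p) * avg Q w)"
proof -
  have QD: "Q \<in> dyadic_subcubes Q0" using Q dyadic_dcube by simp
  note QL = dyadic_lmeasurable[OF QD]
  have QS: "Q \<in> sets lebesgue" using QL(1) by (rule fmeasurableD)
  define C where "C = (3 / 4) powr (1 - p) * (D * (\<epsilon> * CB) powr p) + (1 / 4) powr (1 - p) * CB powr p"
  have C: "0 \<le> C" unfolding C_def using const_bounds by (intro add_nonneg_nonneg mult_nonneg_nonneg) auto
  define e where "e = avg Q w"
  have e: "0 \<le> e" unfolding e_def using w_nonneg_sub[OF QD] by (rule avg_nonneg)
  have "(\<lambda>x. indicator Q x * (indicator Q x *\<^sub>R oscn Q x) powr p) \<in> borel_measurable lebesgue"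
    using set_integrable_imp_measurable[OF oscn_integrable[OF QD QD]] QS
    unfolding set_borel_measurable_def by measurable
  then have "(\<lambda>x. ennreal (indicator Q x * (indicator Q x *\<^sub>R oscn Q x) powr p)) \<in> borel_measurable lebesgue"
    by measurable
  also have "(\<lambda>x. ennreal (indicator Q x * (indicator Q x *\<^sub>R oscn Q x) powr p)) = (\<lambda>x. ennreal (oscn Q x powr p) * indicator Q x)"
    by (auto simp: indicator_def)
  finally have meas: "(\<lambda>x. ennreal (oscn Q x powr p) * indicator Q x) \<in> borel_measurable lebesgue" .
  have "AE x in lebesgue. ennreal (w x powr p) * indicator Q x
      \<le> ennreal ((3 / 4) powr (1 - p)) * (ennreal (oscn Q x powr p) * indicator Q x)
        + ennreal ((1 / 4) powr (1 - p) * (CB * e) powr p) * indicator Q x"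
    using A_bound[OF QD W_L1] w_nonneg_sub[OF QD]
  proof eventually_elim
    case (elim x)
    show ?case
    proof (cases "x \<in> Q")
      case True
      have "w x \<le> oscn Q x + CB * e"
        using elim True norm_triangle_ineq[of "B Q W x" "A Q W x"]
        by (simp add: compl_op_def avg_abs_w[OF QD] e_def)
      then have "w x powr p \<le> (oscn Q x + CB * e) powr p"
        using p elim True by (intro powr_mono2) auto
      also have "\<dots> \<le> (3 / 4) powr (1 - p) * oscn Q x powr p + (1 / 4) powr (1 - p) * (CB * e) powr p"
        using powr_add_le[OF p, of "oscn Q x" "CB * e" "1 / 4"] CB e by simp
      finally show ?thesis
        using True by (simp flip: ennreal_mult ennreal_plus)
    qed simp
  qed
  then have "(\<integral>\<^sup>+x\<in>Q. ennreal (w x powr p) \<partial>lebesgue)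
      \<le> (\<integral>\<^sup>+x. ennreal ((3 / 4) powr (1 - p)) * (ennreal (oscn Q x powr p) * indicator Q x)
        + ennreal ((1 / 4) powr (1 - p) * (CB * e) powr p) * indicator Q x \<partial>lebesgue)"
    by (rule nn_integral_mono_AE)
  also have "\<dots> = ennreal ((3 / 4) powr (1 - p)) * (\<integral>\<^sup>+x\<in>Q. ennreal (oscn Q x powr p) \<partial>lebesgue)
      + ennreal ((1 / 4) powr (1 - p) * (CB * e) powr p) * emeasure lebesgue Q"
    using QS meas by (subst nn_integral_add) (auto simp: nn_integral_cmult)
  also have "\<dots> \<le> ennreal ((3 / 4) powr (1 - p)) * (ennreal (D * (\<epsilon> * CB * e) powr p) * emeasure lebesgue Q)
      + ennreal ((1 / 4) powr (1 - p) * (CB * e) powr p) * emeasure lebesgue Q"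
  proof (intro add_right_mono mult_left_mono)
    have "(\<epsilon> * appr Q) powr p \<le> (\<epsilon> * CB * e) powr p"
      using p eps appr_nonneg appr_le[OF QD] mult_left_mono[of "appr Q" "CB * e" \<epsilon>]
      by (intro powr_mono2) (auto simp: e_def mult.assoc)
    then have "ennreal (D * (\<epsilon> * appr Q) powr p) * emeasure lebesgue Q
        \<le> ennreal (D * (\<epsilon> * CB * e) powr p) * emeasure lebesgue Q"
      using const_bounds by (intro mult_right_mono ennreal_leI mult_left_mono) auto
    with moment_bound[OF Q]
    show "(\<integral>\<^sup>+x\<in>Q. ennreal (oscn Q x powr p) \<partial>lebesgue)
        \<le> ennreal (D * (\<epsilon> * CB * e) powr p) * emeasure lebesgue Q"
      by (rule order_trans)
  qed auto
  also have "\<dots> = ennreal ((3 / 4) powr (1 - p) * (D * (\<epsilon> * CB * e) powr p)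
      + (1 / 4) powr (1 - p) * (CB * e) powr p) * emeasure lebesgue Q"
    using const_bounds by (simp add: ennreal_plus ennreal_mult distrib_right mult.assoc)
  also have "(3 / 4) powr (1 - p) * (D * (\<epsilon> * CB * e) powr p) + (1 / 4) powr (1 - p) * (CB * e) powr p
      = (C powr (1 / p) * e) powr p"
    using p C CB e eps by (simp add: C_def powr_mult powr_powr algebra_simps)
  finally have "Lp_avg_le p Q w (C powr (1 / p) * e)"
    using p C e QL by (intro Lp_avg_leI set_integrable_imp_measurable w_integrable_sub QD) auto
  then show ?thesis by (simp add: C_def e_def)
qed

end

section \<open>Choice of the exponent threshold and conclusion\<close>

theorem corollary4p12:
  fixes CB :: real
  assumes "0 < CB"
  shows "\<exists>pe :: real \<Rightarrow> real.
    (\<forall>\<epsilon>. 0 < \<epsilon> \<and> \<epsilon> < 1 \<and> \<epsilon> < 1 / (2 ^ (DIM('a::euclidean_space) + 2) * CB) \<longrightarrow> 1 < pe \<epsilon>) \<and>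
    filterlim pe at_top (at_right 0) \<and>
    (\<forall>p\<ge>1. \<exists>C. \<forall>\<epsilon> (Q0 :: 'a set)
        (B :: 'a set \<Rightarrow> ('a \<Rightarrow> 'b::{real_normed_field,banach,second_countable_topology}) \<Rightarrow> 'a \<Rightarrow> 'b)
        (w :: 'a \<Rightarrow> real).
      0 < \<epsilon> \<and> \<epsilon> < 1 \<and> \<epsilon> < 1 / (2 ^ (DIM('a) + 2) * CB) \<and> p < pe \<epsilon> \<and>
      is_cube Q0 \<and> local_oscillation Q0 B CB \<and> w \<in> GR_dyadic B \<epsilon> Q0 \<longrightarrow>
        (\<forall>Q\<in>dyadic_subcubes Q0.
          Lp_avg_le p Q (\<lambda>x. norm (B Q (\<lambda>y. of_real (w y)) x))
            (C * \<epsilon> * avg Q (\<lambda>x. norm (compl_op B Q (\<lambda>y. of_real (w y)) x)))) \<and>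
        w \<in> RH_dyadic p Q0)"
proof -
  define M where "M = max 1 CB"
  define L where "L = CB * 2 ^ DIM('a)"
  \<comment> \<open>The value at which \<open>L * \<epsilon> * (4 * M) powr (p - 1)\<close> equals
    1/4, so smaller \<open>p\<close> satisfy the smallness assumption of the iteration. It exceeds 1
    when \<open>4 * L * \<epsilon> < 1\<close>, which is the stated bound on
    \<open>\<epsilon>\<close> because \<open>4 * L\<close> is
    \<open>2 ^ (DIM('a) + 2) * CB\<close>.\<close>
  define pe where "pe \<epsilon> = 1 + ln (inverse \<epsilon> * (1 / (4 * L))) / ln (4 * M)" for \<epsilon>
  define K where "K p = (4 * M) powr p" for p
  define D where "D p = 4 * (K p powr p * (1 + (1 / 4) powr (1 - p) * L powr p))" for p
  have L: "0 < L" "2 ^ (DIM('a) + 2) * CB = 4 * L" using assms by (auto simp: L_def)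
  have lnM: "0 < ln (4 * M)" and M: "1 \<le> M" by (auto simp: M_def)
  have pe_gt_1: "1 < pe \<epsilon>" if "0 < \<epsilon>" "\<epsilon> < 1 / (4 * L)" for \<epsilon>
  proof -
    have "1 < inverse \<epsilon> * (1 / (4 * L))" using that L by (simp add: field_simps)
    then show ?thesis using lnM by (simp add: pe_def)
  qed
  have pe_lim: "filterlim pe at_top (at_right 0)"
  proof -
    have "filterlim (\<lambda>\<epsilon>. inverse \<epsilon> * (1 / (4 * L))) at_top (at_right 0)"
      using L by (intro filterlim_at_top_mult_tendsto_pos[OF tendsto_const] filterlim_inverse_at_top_right) auto
    then have "filterlim (\<lambda>\<epsilon>. ln (inverse \<epsilon> * (1 / (4 * L)))) at_top (at_right 0)"
      by (rule filterlim_compose[OF ln_at_top])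
    then have "filterlim (\<lambda>\<epsilon>. ln (inverse \<epsilon> * (1 / (4 * L))) * (1 / ln (4 * M))) at_top (at_right 0)"
      using lnM by (intro filterlim_at_top_mult_tendsto_pos[OF tendsto_const]) auto
    then show ?thesis
      unfolding pe_def by (intro filterlim_tendsto_add_at_top[OF tendsto_const]) simp
  qed
  have bounds: "Lp_avg_le p Q (\<lambda>x. norm (B Q (\<lambda>y. of_real (w y)) x))
        (D p powr (1 / p) * \<epsilon> * avg Q (\<lambda>x. norm (compl_op B Q (\<lambda>y. of_real (w y)) x))) \<and>
      Lp_avg_le p Q w
        (((3 / 4) powr (1 - p) * (D p * (\<epsilon> * CB) powr p) + (1 / 4) powr (1 - p) * CB powr p) powr (1 / p) * avg Q w)"
    if p: "1 \<le> p" and eps: "0 < \<epsilon>" "\<epsilon> < 1" "p < pe \<epsilon>"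
      and osc: "local_oscillation Q0 B CB" and GR: "w \<in> GR_dyadic B \<epsilon> Q0" and Q: "Q \<in> dyadic_subcubes Q0"
    for p \<epsilon> and Q0 Q :: "'a set" and w :: "'a \<Rightarrow> real"
      and B :: "'a set \<Rightarrow> ('a \<Rightarrow> 'b) \<Rightarrow> 'a \<Rightarrow> 'b"
  proof -
    have "(p - 1) * ln (4 * M) \<le> ln (inverse \<epsilon> * (1 / (4 * L)))"
      using eps(3) lnM by (simp add: pe_def field_simps)
    then have "exp ((p - 1) * ln (4 * M)) \<le> inverse \<epsilon> * (1 / (4 * L))"
      using eps(1) L by (subst (asm) ln_ge_iff) auto
    then have small: "L * \<epsilon> * (4 * M) powr (p - 1) \<le> 1 / 4"
      using eps(1) L M by (simp add: powr_def field_simps)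
    \<comment> \<open>Corner and side length may vary with \<open>Q\<close>, but no constant depends
      on them, so the bounds are uniform over all subcubes.\<close>
    obtain a l k x0 where Q': "0 < l" "Q0 = cube a l" "x0 \<in> Q0" "Q = dcube a l k x0"
      using dyadic_subcubeE[OF Q] .
    interpret small_gurov_reshetnyak_weight a l B CB \<epsilon> w p M L "K p" "D p"
      using Q'(1) assms eps p small osc GR unfolding Q'(2)
      by unfold_locales (auto simp: M_def L_def K_def D_def)
    show ?thesis
      using Lp_avg_le_oscn[OF Q'(4)] Lp_avg_le_w[OF Q'(4)] Q'(2,3) by blast
  qed
  show ?thesis
    unfolding L(2)
  proof (rule exI[of _ pe], intro conjI)
    show "\<forall>\<epsilon>. 0 < \<epsilon> \<and> \<epsilon> < 1 \<and> \<epsilon> < 1 / (4 * L) \<longrightarrow> 1 < pe \<epsilon>"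
      using pe_gt_1 by blast
  next
    show "filterlim pe at_top (at_right 0)" by (rule pe_lim)
  next
    show "\<forall>p\<ge>1. \<exists>C. \<forall>\<epsilon> (Q0 :: 'a set)
        (B :: 'a set \<Rightarrow> ('a \<Rightarrow> 'b) \<Rightarrow> 'a \<Rightarrow> 'b) (w :: 'a \<Rightarrow> real).
      0 < \<epsilon> \<and> \<epsilon> < 1 \<and> \<epsilon> < 1 / (4 * L) \<and> p < pe \<epsilon> \<and>
      is_cube Q0 \<and> local_oscillation Q0 B CB \<and> w \<in> GR_dyadic B \<epsilon> Q0 \<longrightarrow>
        (\<forall>Q\<in>dyadic_subcubes Q0.
          Lp_avg_le p Q (\<lambda>x. norm (B Q (\<lambda>y. of_real (w y)) x))
            (C * \<epsilon> * avg Q (\<lambda>x. norm (compl_op B Q (\<lambda>y. of_real (w y)) x)))) \<and>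
        w \<in> RH_dyadic p Q0"
    proof (intro allI impI, rule exI[of _ "D p powr (1 / p)" for p], intro allI impI, elim conjE, rule conjI)
      fix p \<epsilon> :: real and Q0 :: "'a set" and B :: "'a set \<Rightarrow> ('a \<Rightarrow> 'b) \<Rightarrow> 'a \<Rightarrow> 'b" and w :: "'a \<Rightarrow> real"
      assume *: "1 \<le> p" "0 < \<epsilon>" "\<epsilon> < 1" "p < pe \<epsilon>" "local_oscillation Q0 B CB" "w \<in> GR_dyadic B \<epsilon> Q0"
      show "\<forall>Q\<in>dyadic_subcubes Q0.
          Lp_avg_le p Q (\<lambda>x. norm (B Q (\<lambda>y. of_real (w y)) x))
            (D p powr (1 / p) * \<epsilon> * avg Q (\<lambda>x. norm (compl_op B Q (\<lambda>y. of_real (w y)) x)))"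
        using bounds[OF *] by blast
      have "set_integrable lebesgue Q0 w" "AE x\<in>Q0 in lebesgue. 0 \<le> w x"
        using *(6) by (auto simp: GR_dyadic_def)
      then show "w \<in> RH_dyadic p Q0"
        using bounds[OF *] unfolding RH_dyadic_def by blast
    qed
  qed
qed

end
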